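(* Let $k\ge 1$ and let $X$ be a finite connected simplicial complex on $n$ vertices whose $k$-skeleton is the same as the $k$-skeleton of the clique complex of its $1$-skeleton $G_X$. If $$\lambda_2(G_X) > \frac{kn}{k+1} + (k+1)\, D_k(X,k+1),$$ then $\widetilde{H}^k(X) = 0$. Here $D_k(X,k+1)$ is the maximum over all $k$-simplices $\sigma$ of $X$ of the number of vertices $u$ of $X$ such that $u\notin \mathrm{lk}_X(\sigma)$ and $u\in \mathrm{lk}_X(\sigma\setminus\{v\})$ for all $k+1$ vertices $v\in\sigma$.
   Context: Simplicial complexes are finite abstract simplicial complexes. The $1$-skeleton $G_X$ of $X$ is the graph whose vertices are the $0$-simplices and whose edges are the $1$-simplices of $X$; $X$ is connected if $G_X$ is connected. The clique complex of a graph $G$ is the complex whose simplices are the vertex subsets spanning complete subgraphs of $G$. The link of a simplex $\sigma\in X$ is $\mathrm{lk}_X(\sigma)=\{\eta\in X : \sigma\cup\eta\in X,\ \sigma\cap\eta=\emptyset\}$; for a vertex $u$, $u\in \mathrm{lk}_X(\sigma)$ means $\{u\}\in\mathrm{lk}_X(\sigma)$. A maximum over the empty set is taken to be $0$. For a graph $G$ with vertex set $V$, the (unnormalized) Laplacian $L(G)$ is the $V\times V$ matrix with $L(G)(x,x)=\deg(x)$, $L(G)(x,y)=-1$ if $x,y$ are adjacent and $0$ otherwise; its eigenvalues in ascending order are $0=\lambda_1(G)\le\lambda_2(G)\le\dots\le\lambda_{|V|}(G)$, and $\lambda_2(G)$ is the spectral gap. $\widetilde{H}^k(X)$ is the $k$-th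 reduced simplicial cohomology of $X$ with real coefficients. *)

theory Defs
  imports
    Complex_Main
    "HOL-Combinatorics.Permutations"
    "HOL-Computational_Algebra.Polynomial"
    "HOL-Library.Multiset"
    "HOL-Algebra.Elementary_Groups"
    "Jordan_Normal_Form.Char_Poly"
begin

section \<open>Finite simple graphs and their Laplacian eigenvalues\<close>

text \<open>A graph is a pair of a vertex set and a set of edges, an edge being a two-element vertex set.\<close>

type_synonym 'a graph = "'a set \<times> 'a set set"

definition graph_adj :: "'a graph \<Rightarrow> 'a \<Rightarrow> 'a \<Rightarrow> bool" where
  "graph_adj G x y \<longleftrightarrow> x \<in> fst G \<and> y \<in> fst G \<and> x \<noteq> y \<and> {x, y} \<in> snd G"

definition graph_degree :: "'a graph \<Rightarrow> 'a \<Rightarrow> nat" where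
  "graph_degree G x = card {y. graph_adj G x y}"

definition graph_connected :: "'a graph \<Rightarrow> bool" where
  "graph_connected G \<longleftrightarrow>
     fst G \<noteq> {} \<and> (\<forall>x\<in>fst G. \<forall>y\<in>fst G. (graph_adj G)\<^sup>*\<^sup>* x y)"

definition laplacian :: "'a graph \<Rightarrow> 'a \<Rightarrow> 'a \<Rightarrow> real" where
  "laplacian G x y =
     (if x = y then real (graph_degree G x) else if graph_adj G x y then - 1 else 0)"

text \<open>
  Matrices of type \<^typ>\<open>real mat\<close> are indexed by numbers, so the vertices are numbered in an
  arbitrary way. Another numbering conjugates the matrix by a permutation matrix and leaves the
  characteristic polynomial unchanged.
\<close>

definition vertex_enum :: "'a graph \<Rightarrow> 'a list" where
  "vertex_enum G = (SOME xs. distinct xs \<and> set xs = fst G)"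

definition laplacian_mat :: "'a graph \<Rightarrow> real mat" where
  "laplacian_mat G =
     mat (card (fst G)) (card (fst G))
       (\<lambda>(i, j). laplacian G (vertex_enum G ! i) (vertex_enum G ! j))"

text \<open>
  The \<open>i\<close>-th eigenvalue in ascending order, counted with multiplicity and starting at \<open>i = 1\<close>.
  It is meaningful for \<open>1 \<le> i \<le> card (fst G)\<close>; the real symmetric Laplacian has exactly
  \<open>card (fst G)\<close> real eigenvalues.
\<close>

definition laplacian_eigenvalue :: "'a graph \<Rightarrow> nat \<Rightarrow> real" where
  "laplacian_eigenvalue G i =
     sorted_list_of_multiset (proots (char_poly (laplacian_mat G))) ! (i - 1)"

definition spectral_gap :: "'a graph \<Rightarrow> real" where
  "spectral_gap G = laplacian_eigenvalue G 2"


section \<open>Finite abstract simplicial complexes\<close>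

text \<open>The empty simplex, of dimension \<open>-1\<close>, belongs to every complex.\<close>

definition finite_complex :: "'a set set \<Rightarrow> bool" where
  "finite_complex X \<longleftrightarrow>
     finite X \<and> {} \<in> X \<and> (\<forall>\<sigma>\<in>X. finite \<sigma> \<and> (\<forall>\<tau>. \<tau> \<subseteq> \<sigma> \<longrightarrow> \<tau> \<in> X))"

definition complex_simplices :: "'a set set \<Rightarrow> nat \<Rightarrow> 'a set set" where
  "complex_simplices X k = {\<sigma> \<in> X. card \<sigma> = k + 1}"

definition complex_vertices :: "'a set set \<Rightarrow> 'a set" where
  "complex_vertices X = {v. {v} \<in> X}"

definition complex_skeleton :: "nat \<Rightarrow> 'a set set \<Rightarrow> 'a set set" where
  "complex_skeleton k X = {\<sigma> \<in> X. card \<sigma> \<le> k + 1}"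

definition one_skeleton_graph :: "'a set set \<Rightarrow> 'a graph" where
  "one_skeleton_graph X = (complex_vertices X, complex_simplices X 1)"

definition complex_connected :: "'a set set \<Rightarrow> bool" where
  "complex_connected X \<longleftrightarrow> graph_connected (one_skeleton_graph X)"

definition clique_complex :: "'a graph \<Rightarrow> 'a set set" where
  "clique_complex G =
     {\<sigma>. finite \<sigma> \<and> \<sigma> \<subseteq> fst G \<and> (\<forall>x\<in>\<sigma>. \<forall>y\<in>\<sigma>. x \<noteq> y \<longrightarrow> graph_adj G x y)}"

definition complex_link :: "'a set set \<Rightarrow> 'a set \<Rightarrow> 'a set set" where
  "complex_link X \<sigma> = {\<eta> \<in> X. \<sigma> \<union> \<eta> \<in> X \<and> \<sigma> \<inter> \<eta> = {}}"

text \<open>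
  The number \<open>D\<^sub>k(X, k + 1)\<close>. Inserting \<open>0\<close> only matters when there are no \<open>k\<close>-simplices, where
  the maximum is \<open>0\<close> by convention.
\<close>

definition D_max :: "'a set set \<Rightarrow> nat \<Rightarrow> nat" where
  "D_max X k =
     Max (insert 0
       ((\<lambda>\<sigma>. card {u \<in> complex_vertices X.
                {u} \<notin> complex_link X \<sigma> \<and> (\<forall>v\<in>\<sigma>. {u} \<in> complex_link X (\<sigma> - {v}))})
        ` complex_simplices X k))"


section \<open>Reduced simplicial cohomology with real coefficients\<close>

text \<open>
  An ordered simplex is a list of distinct vertices whose set is a simplex. Cochains are the
  alternating real functions on ordered simplices, extended by \<open>0\<close> to all other lists.
  They are indexed by the number of vertices: \<open>cochains X p\<close> is the space of
  \<open>(p - 1)\<close>-cochains, and \<open>p = 0\<close> is the augmentation degree \<open>-1\<close> of the reduced complex.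
\<close>

definition ordered_simplices :: "'a set set \<Rightarrow> nat \<Rightarrow> 'a list set" where
  "ordered_simplices X p = {xs. distinct xs \<and> length xs = p \<and> set xs \<in> X}"

definition cochains :: "'a set set \<Rightarrow> nat \<Rightarrow> ('a list \<Rightarrow> real) set" where
  "cochains X p =
     {\<phi>. (\<forall>xs. xs \<notin> ordered_simplices X p \<longrightarrow> \<phi> xs = 0) \<and>
         (\<forall>xs\<in>ordered_simplices X p. \<forall>\<pi>. \<pi> permutes {..<p} \<longrightarrow>
            \<phi> (permute_list \<pi> xs) = of_int (sign \<pi>) * \<phi> xs)}"

text \<open>The map from \<^term>\<open>cochains X p\<close> to \<^term>\<open>cochains X (p + 1)\<close>; in the sum, the \<open>i\<close>-th vertex is omitted.\<close>

definition coboundary :: "'a set set \<Rightarrow> nat \<Rightarrow> ('a list \<Rightarrow> real) \<Rightarrow> 'a list \<Rightarrow> real" where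
  "coboundary X p \<phi> xs =
     (if xs \<in> ordered_simplices X (p + 1)
      then \<Sum>i<p + 1. (- 1) ^ i * \<phi> (take i xs @ drop (Suc i) xs)
      else 0)"

definition reduced_cocycles :: "'a set set \<Rightarrow> nat \<Rightarrow> ('a list \<Rightarrow> real) set" where
  "reduced_cocycles X k = {\<phi> \<in> cochains X (k + 1). \<forall>xs. coboundary X (k + 1) \<phi> xs = 0}"

definition reduced_coboundaries :: "'a set set \<Rightarrow> nat \<Rightarrow> ('a list \<Rightarrow> real) set" where
  "reduced_coboundaries X k = coboundary X k ` cochains X k"

definition reduced_cocycle_group :: "'a set set \<Rightarrow> nat \<Rightarrow> ('a list \<Rightarrow> real) monoid" where
  "reduced_cocycle_group X k =
     \<lparr>carrier = reduced_cocycles X k, monoid.mult = (\<lambda>\<phi> \<psi> xs. \<phi> xs + \<psi> xs), one = (\<lambda>xs. 0)\<rparr>"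

text \<open>The additive group of the real vector space of \<open>k\<close>-cocycles modulo \<open>k\<close>-coboundaries.\<close>

definition reduced_cohomology :: "'a set set \<Rightarrow> nat \<Rightarrow> ('a list \<Rightarrow> real) set monoid" where
  "reduced_cohomology X k = reduced_cocycle_group X k Mod reduced_coboundaries X k"

end

theory Submission
  imports Defs "HOL-Analysis.Function_Topology" "HOL-Analysis.Convex"
begin

text \<open>
  Let \<open>G\<close> be the 1-skeleton, \<open>L\<close> its Laplacian, and let \<open>\<phi>\<close> be a \<open>k\<close>-cocycle. Subtracting the orthogonal
  projection to the coboundaries changes neither the class of \<open>\<phi>\<close> nor the cocycle condition and makes
  \<open>\<phi>\<close> coclosed: \<open>\<Sum>\<^sub>u \<phi> (u # \<tau>) = 0\<close> for every \<open>\<tau>\<close> (\<open>exists_coclosed_representative\<close>). It must be shown that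
  such a \<open>\<phi>\<close> is zero. All sums below run over ordered simplices, that is, over lists.

  For an ordered \<open>(k - 1)\<close>-simplex \<open>\<tau>\<close>, consider the function \<open>f\<^sub>\<tau> u = \<phi> (u # \<tau>)\<close> on the vertices. It has
  mean zero, so \<open>\<lambda>\<^sub>2 \<parallel>f\<^sub>\<tau>\<parallel>\<^sup>2 \<le> \<langle>L f\<^sub>\<tau>, f\<^sub>\<tau>\<rangle>\<close> (\<open>spectral_gap_le_rayleigh\<close>). Summation over \<open>\<tau>\<close> gives
  \<open>\<lambda>\<^sub>2 \<parallel>\<phi>\<parallel>\<^sup>2 \<le> \<Sum>\<^sub>\<tau> \<langle>L f\<^sub>\<tau>, f\<^sub>\<tau>\<rangle>\<close>.

  The right side is bounded from above by comparison with \<open>\<parallel>d \<phi>\<parallel>\<^sup>2\<close>, where the formal coboundary is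
  summed over all cliques with \<open>k + 2\<close> vertices, including those that are not simplices. The
  off-diagonal terms \<open>\<phi> (x # \<tau>) * \<phi> (y # \<tau>)\<close> with \<open>x\<close>, \<open>y\<close> adjacent are the same in both quadratic
  forms, up to normalisation. The diagonal terms differ, at a simplex \<open>\<sigma>\<close>, by the sum of the degrees
  of its vertices minus the number of vertices that extend \<open>\<sigma>\<close> to a larger clique, and this is at most
  \<open>k n\<close> (\<open>sum_degree_clique_le\<close>). Finally \<open>d \<phi>\<close> vanishes on the simplices, and the cliques that are not
  simplices are controlled by \<open>D = D_max X k\<close> and Cauchy-Schwarz. Altogether
  (\<open>cocycle_laplacian_bound\<close>)
  \<open>(k + 1) \<lambda>\<^sub>2 \<parallel>\<phi>\<parallel>\<^sup>2 \<le> (k n + (k + 2) D) \<parallel>\<phi>\<parallel>\<^sup>2\<close>.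
  As \<open>k + 2 \<le> (k + 1)\<^sup>2\<close> for \<open>k \<ge> 1\<close>, the hypothesis on \<open>\<lambda>\<^sub>2\<close> forces \<open>\<phi> = 0\<close>.
\<close>

section \<open>Cochains as antisymmetric functions on lists\<close>

definition del :: "nat \<Rightarrow> 'a list \<Rightarrow> 'a list" where
  "del i xs = take i xs @ drop (Suc i) xs"

lemma del_Cons [simp]: "del 0 (x # xs) = xs" "del (Suc i) (x # xs) = x # del i xs"
  by (simp_all add: del_def)

definition alt_sum :: "('a list \<Rightarrow> real) \<Rightarrow> 'a list \<Rightarrow> real" where
  "alt_sum f xs = (\<Sum>i<length xs. (- 1) ^ i * f (del i xs))"

lemma alt_sum_Nil [simp]: "alt_sum f [] = 0"
  by (simp add: alt_sum_def)

text \<open>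
  This recursion replaces all bookkeeping with pairs of omitted positions: both \<open>d \<circ> d = 0\<close> and the
  antisymmetry of \<open>d \<phi>\<close> follow from it by induction on the list with \<open>f\<close> arbitrary.
\<close>

lemma alt_sum_Cons [simp]: "alt_sum f (x # xs) = f xs - alt_sum (\<lambda>ys. f (x # ys)) xs"
  unfolding alt_sum_def by (simp add: sum.lessThan_Suc_shift sum_negf del: sum.lessThan_Suc)

lemma alt_sum_diff: "alt_sum (\<lambda>xs. f xs - g xs) xs = alt_sum f xs - alt_sum g xs"
  by (simp add: alt_sum_def algebra_simps sum_subtractf)

lemma alt_sum_alt_sum: "alt_sum (alt_sum f) xs = 0"
  by (induction xs arbitrary: f) (simp_all add: alt_sum_diff)

text \<open>
  Adjacent transpositions generate all permutations, so this is the alternating property. Since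
  cochains vanish off the ordered simplices, and being an ordered simplex does not depend on the
  order, it can be required on all lists at once, which frees the inductions from side conditions.
\<close>

definition antisymmetric :: "('a list \<Rightarrow> real) \<Rightarrow> bool" where
  "antisymmetric f \<longleftrightarrow> (\<forall>as x y bs. f (as @ y # x # bs) = - f (as @ x # y # bs))"

lemma antisymmetricD: "antisymmetric f \<Longrightarrow> f (as @ y # x # bs) = - f (as @ x # y # bs)"
  unfolding antisymmetric_def by blast

lemma antisymmetric_Cons:
  assumes "antisymmetric f"
  shows "antisymmetric (\<lambda>xs. f (x # xs))"
  unfolding antisymmetric_def
proof (intro allI)
  fix as y z bs
  show "f (x # as @ z # y # bs) = - f (x # as @ y # z # bs)"
    using antisymmetricD[OF assms, of "x # as" z y bs] by simp
qed

lemma alt_sum_uminus: "alt_sum (\<lambda>xs. - f xs) xs = - alt_sum f xs"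
  by (simp add: alt_sum_def sum_negf)

lemma antisymmetric_alt_sum:
  assumes "antisymmetric f"
  shows "antisymmetric (alt_sum f)"
proof -
  have "alt_sum f (as @ y # x # bs) = - alt_sum f (as @ x # y # bs)" for as x y bs
    using assms
  proof (induction as arbitrary: f)
    case Nil
    have "(\<lambda>ys. f (y # x # ys)) = (\<lambda>ys. - f (x # y # ys))"
      using antisymmetricD[OF Nil, of "[]" y x] by (intro ext) simp
    then show ?case by (simp add: alt_sum_uminus)
  next
    case (Cons a as)
    show ?case
      using Cons.IH[OF antisymmetric_Cons[OF Cons.prems]] antisymmetricD[OF Cons.prems, of as y x bs]
      by simp
  qed
  then show ?thesis unfolding antisymmetric_def by blast
qed

lemma antisymmetric_move_to_front_append:
  assumes "antisymmetric f"
  shows "f (as @ x # bs) = (- 1) ^ length as * f (x # as @ bs)"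
  using assms
proof (induction as arbitrary: f)
  case (Cons a as)
  have "f (a # as @ x # bs) = (- 1) ^ length as * f (a # x # as @ bs)"
    using Cons.IH[OF antisymmetric_Cons[OF Cons.prems]] by simp
  also have "f (a # x # as @ bs) = - f (x # a # as @ bs)"
    using antisymmetricD[OF Cons.prems, of "[]" a x "as @ bs"] by simp
  finally show ?case by simp
qed simp

lemma antisymmetric_move_to_front:
  assumes "antisymmetric f" "i < length xs"
  shows "f (xs ! i # del i xs) = (- 1) ^ i * f xs"
proof -
  have "f xs = (- 1) ^ i * f (xs ! i # del i xs)"
    using antisymmetric_move_to_front_append[OF assms(1), of "take i xs" "xs ! i" "drop (Suc i) xs"]
      assms(2) by (simp add: id_take_nth_drop[symmetric] del_def)
  then show ?thesis by simp
qed

lemma permute_list_adjacent: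
  "permute_list (Transposition.transpose (length as) (Suc (length as))) (as @ x # y # bs) = as @ y # x # bs"
proof -
  have "permute_list (Transposition.transpose (length as) (Suc (length as))) (as @ x # y # bs) ! i
      = (as @ y # x # bs) ! i" if "i < length (as @ y # x # bs)" for i
  proof -
    have p: "permute_list (Transposition.transpose (length as) (Suc (length as))) (as @ x # y # bs) ! i
        = (as @ x # y # bs) ! Transposition.transpose (length as) (Suc (length as)) i"
      using that by (intro permute_list_nth permutes_swap_id) auto
    consider "i < length as" | "i = length as" | "i = Suc (length as)"
      | j where "i = length as + Suc (Suc j)"
      using less_iff_Suc_add[of "Suc (length as)" i] by fastforce
    then show ?thesis
      unfolding p by cases (simp_all add: Transposition.transpose_def nth_append)
  qed
  then show ?thesis by (intro nth_equalityI) auto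
qed

lemma ordered_simplices_permute:
  "mset xs = mset ys \<Longrightarrow> xs \<in> ordered_simplices X p \<longleftrightarrow> ys \<in> ordered_simplices X p"
  unfolding ordered_simplices_def
  by (metis (no_types, lifting) mem_Collect_eq mset_eq_imp_distinct_iff mset_eq_length mset_eq_setD)

lemma antisymmetric_transpose:
  assumes "antisymmetric f" "i < j" "j < length xs"
  shows "f (permute_list (Transposition.transpose i j) xs) = - f xs"
  using assms(2,3)
proof (induction "j - i" arbitrary: j xs)
  case (Suc d)
  have adj: "f (permute_list (Transposition.transpose i (Suc i)) ys) = - f ys" if "Suc i < length ys" for i ys
  proof -
    have ys: "take i ys @ ys ! i # ys ! Suc i # drop (Suc (Suc i)) ys = ys"
      using that by (simp add: Cons_nth_drop_Suc Suc_lessD)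
    have len: "length (take i ys) = i" using that by simp
    have "permute_list (Transposition.transpose i (Suc i)) ys
        = take i ys @ ys ! Suc i # ys ! i # drop (Suc (Suc i)) ys"
      using permute_list_adjacent[of "take i ys" "ys ! i" "ys ! Suc i" "drop (Suc (Suc i)) ys"]
      unfolding ys len .
    also have "f \<dots> = - f ys"
      using antisymmetricD[OF assms(1), of "take i ys" "ys ! Suc i" "ys ! i"  "drop (Suc (Suc i)) ys"]
      unfolding ys .
    finally show ?thesis .
  qed
  show ?case
  proof (cases "j = Suc i")
    case True
    then show ?thesis using adj Suc.prems by simp
  next
    case False
    then obtain j' where j: "j = Suc j'" "i < j'" using Suc.prems by (cases j) auto
    \<comment> \<open>a longer transposition is a shorter one conjugated by an adjacent one, three sign changes in all\<close>
    let ?a = "Transposition.transpose j' (Suc j')" and ?b = "Transposition.transpose i j'"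
    have eq: "Transposition.transpose i j = ?a \<circ> ?b \<circ> ?a"
      using j by (auto simp: Transposition.transpose_def fun_eq_iff)
    have pa: "?a permutes {..<length xs}" and pb: "?b permutes {..<length xs}"
      using j Suc.prems by (auto intro!: permutes_swap_id)
    have "f (permute_list (Transposition.transpose i j) xs)
        = f (permute_list ?a (permute_list ?b (permute_list ?a xs)))"
      unfolding eq using pa pb permute_list_compose[of ?a xs "?a \<circ> ?b"] permute_list_compose[of ?b xs ?a]
      by (simp add: comp_assoc permute_list_compose)
    also have "\<dots> = - f (permute_list ?b (permute_list ?a xs))"
      using adj j Suc.prems by simp
    also have "\<dots> = f (permute_list ?a xs)"
      using Suc.hyps(1)[of j' "permute_list ?a xs"] j Suc.hyps(2) Suc.prems by simp
    also have "\<dots> = - f xs" using adj j Suc.prems by simp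
    finally show ?thesis .
  qed
qed simp

lemma antisymmetric_permute:
  assumes "antisymmetric f" "\<pi> permutes {..<length xs}"
  shows "f (permute_list \<pi> xs) = of_int (sign \<pi>) * f xs"
  using finite_lessThan assms(2)
proof (induction arbitrary: rule: permutes_rev_induct)
  case id
  then show ?case by simp
next
  case (swap a b p)
  then have perm: "Transposition.transpose a b permutes {..<length xs}"
    by (simp add: permutes_swap_id)
  have t: "f (permute_list (Transposition.transpose a b) ys)
      = of_int (sign (Transposition.transpose a b)) * f ys" if "length ys = length xs" for ys
    using swap.hyps that antisymmetric_transpose[OF assms(1), of a b ys]
      antisymmetric_transpose[OF assms(1), of b a ys]
    by (cases a b rule: linorder_cases) (auto simp: sign_swap_id transpose_commute)
  have sign: "sign (p \<circ> Transposition.transpose a b) = sign p * sign (Transposition.transpose a b)"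
    using swap.hyps perm by (intro sign_compose) (auto simp: permutation_permutes permutation_swap_id)
  have "f (permute_list (p \<circ> Transposition.transpose a b) xs)
      = of_int (sign (Transposition.transpose a b)) * (of_int (sign p) * f xs)"
    unfolding permute_list_compose[OF perm] using t[of "permute_list p xs"] swap.IH by simp
  then show ?case
    unfolding sign of_int_mult by (simp only: mult_ac)
qed

lemma cochains_iff:
  "\<phi> \<in> cochains X p \<longleftrightarrow> (\<forall>xs. xs \<notin> ordered_simplices X p \<longrightarrow> \<phi> xs = 0) \<and> antisymmetric \<phi>"
proof (intro iffI conjI)
  assume L: "\<phi> \<in> cochains X p"
  then show supp: "\<forall>xs. xs \<notin> ordered_simplices X p \<longrightarrow> \<phi> xs = 0"
    by (simp add: cochains_def)
  show "antisymmetric \<phi>"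
    unfolding antisymmetric_def
  proof (intro allI)
    fix as :: "'a list" and x y bs
    let ?u = "as @ x # y # bs" and ?v = "as @ y # x # bs"
    show "\<phi> ?v = - \<phi> ?u"
    proof (cases "?u \<in> ordered_simplices X p")
      case True
      then have "Transposition.transpose (length as) (Suc (length as)) permutes {..<p}"
        by (auto simp: ordered_simplices_def intro!: permutes_swap_id)
      moreover have "\<pi> permutes {..<p} \<Longrightarrow> \<phi> (permute_list \<pi> ?u) = of_int (sign \<pi>) * \<phi> ?u" for \<pi>
        using L True by (simp add: cochains_def)
      ultimately have "\<phi> (permute_list (Transposition.transpose (length as) (Suc (length as))) ?u)
          = of_int (sign (Transposition.transpose (length as) (Suc (length as)))) * \<phi> ?u"
        by blast
      then show ?thesis
        unfolding permute_list_adjacent by (simp add: sign_swap_id)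
    next
      case False
      then have "?v \<notin> ordered_simplices X p"
        using ordered_simplices_permute[of ?u ?v] by simp
      then show ?thesis using supp False by simp
    qed
  qed
next
  assume R: "(\<forall>xs. xs \<notin> ordered_simplices X p \<longrightarrow> \<phi> xs = 0) \<and> antisymmetric \<phi>"
  show "\<phi> \<in> cochains X p"
    unfolding cochains_def
  proof (intro CollectI conjI ballI allI impI)
    fix xs \<pi> assume "xs \<in> ordered_simplices X p" "\<pi> permutes {..<p}"
    then show "\<phi> (permute_list \<pi> xs) = of_int (sign \<pi>) * \<phi> xs"
      using antisymmetric_permute[of \<phi> \<pi> xs] R by (simp add: ordered_simplices_def)
  qed (use R in auto)
qed

lemma coboundary_alt_sum:
  "coboundary X p \<phi> xs = (if xs \<in> ordered_simplices X (p + 1) then alt_sum \<phi> xs else 0)"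
  by (auto simp: coboundary_def alt_sum_def del_def ordered_simplices_def)

lemma coboundary_in_cochains:
  assumes "\<phi> \<in> cochains X p"
  shows "coboundary X p \<phi> \<in> cochains X (p + 1)"
proof -
  have "antisymmetric (alt_sum \<phi>)"
    using assms by (simp add: cochains_iff antisymmetric_alt_sum)
  then have flip: "alt_sum \<phi> (as @ y # x # bs) = - alt_sum \<phi> (as @ x # y # bs)" for as x y bs
    by (rule antisymmetricD)
  have mem: "as @ y # x # bs \<in> ordered_simplices X (p + 1) \<longleftrightarrow> as @ x # y # bs \<in> ordered_simplices X (p + 1)"
    for as x y bs by (rule ordered_simplices_permute) simp
  have "coboundary X p \<phi> (as @ y # x # bs) = - coboundary X p \<phi> (as @ x # y # bs)" for as x y bs
    unfolding coboundary_alt_sum mem[of as y x bs] flip[of as y x bs] by (cases "as @ x # y # bs \<in> ordered_simplices X (p + 1)") simp_all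
  then have "antisymmetric (coboundary X p \<phi>)"
    unfolding antisymmetric_def by blast
  then show ?thesis
    unfolding cochains_iff by (simp add: coboundary_alt_sum)
qed

lemma del_in_ordered_simplices:
  assumes "finite_complex X" "xs \<in> ordered_simplices X (p + 1)" "i < p + 1"
  shows "del i xs \<in> ordered_simplices X p"
proof -
  have "set (del i xs) \<subseteq> set xs"
    by (auto simp: del_def dest: in_set_takeD in_set_dropD)
  then have "set (del i xs) \<in> X"
    using assms(1,2) by (auto simp: finite_complex_def ordered_simplices_def)
  moreover have "distinct (del i xs)"
    using assms(2) by (auto simp: ordered_simplices_def del_def set_take_disj_set_drop_if_distinct)
  ultimately show ?thesis
    using assms(2,3) by (simp add: ordered_simplices_def del_def)
qed

lemma coboundary_coboundary:
  assumes "finite_complex X"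
  shows "coboundary X (p + 1) (coboundary X p \<phi>) xs = 0"
proof (cases "xs \<in> ordered_simplices X (p + 1 + 1)")
  case True
  then have "alt_sum (coboundary X p \<phi>) xs = alt_sum (alt_sum \<phi>) xs"
    unfolding alt_sum_def[of "coboundary X p \<phi>"] alt_sum_def[of "alt_sum \<phi>"]
    using del_in_ordered_simplices[OF assms True]
    by (intro sum.cong) (auto simp: coboundary_alt_sum ordered_simplices_def)
  then show ?thesis
    by (simp add: coboundary_alt_sum alt_sum_alt_sum)
qed (simp add: coboundary_alt_sum)

lemma antisymmetric_linear_combination:
  assumes "antisymmetric f" "antisymmetric g"
  shows "antisymmetric (\<lambda>xs. a * f xs + b * g xs)"
  unfolding antisymmetric_def
proof (intro allI)
  fix as x y bs
  show "a * f (as @ y # x # bs) + b * g (as @ y # x # bs)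
      = - (a * f (as @ x # y # bs) + b * g (as @ x # y # bs))"
    using antisymmetricD[OF assms(1), of as y x bs] antisymmetricD[OF assms(2), of as y x bs] by simp
qed

lemma cochains_linear_combination:
  assumes "\<phi> \<in> cochains X p" "\<psi> \<in> cochains X p"
  shows "(\<lambda>xs. a * \<phi> xs + b * \<psi> xs) \<in> cochains X p"
  using assms antisymmetric_linear_combination[of \<phi> \<psi> a b] by (simp add: cochains_iff)

lemma coboundary_linear_combination:
  "coboundary X p (\<lambda>xs. a * \<phi> xs + b * \<psi> xs) = (\<lambda>xs. a * coboundary X p \<phi> xs + b * coboundary X p \<psi> xs)"
  by (auto simp: fun_eq_iff coboundary_def sum_distrib_left sum.distrib algebra_simps
      intro!: sum.cong simp del: sum.lessThan_Suc)

section \<open>The spectral gap and mean-zero functions\<close>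

text \<open>For finite \<open>V\<close>, the unit sphere of the functions supported on \<open>V\<close> is a closed subset of this cube, hence compact.\<close>

lemma compact_cube:
  "compact {g :: 'v \<Rightarrow> real. \<forall>x. if x \<in> V then \<bar>g x\<bar> \<le> 1 else g x = 0}"
proof -
  define S where "S = (\<lambda>x. if x \<in> V then {-1..1::real} else {0})"
  have eq: "{g :: 'v \<Rightarrow> real. \<forall>x. if x \<in> V then \<bar>g x\<bar> \<le> 1 else g x = 0} = PiE UNIV S"
    by (auto simp: S_def PiE_UNIV_domain abs_le_iff split: if_splits)
  have "compactin (product_topology (\<lambda>x. euclidean) UNIV) (PiE UNIV S)"
    unfolding compactin_PiE by (auto simp: S_def)
  then show ?thesis
    unfolding eq euclidean_product_topology by simp
qed

text \<open>
  The variational half of the spectral theorem: the Rayleigh quotient has a minimiser \<open>g\<close> among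
  the mean-zero functions, by compactness of the unit sphere. The residual \<open>r = A g - \<mu> g\<close> is again
  mean-zero, because \<open>A\<close> is symmetric and kills constants; so \<open>g + t r\<close> is an admissible competitor,
  and the term linear in \<open>t\<close>, which is \<open>2 t \<parallel>r\<parallel>\<^sup>2\<close>, must vanish.
\<close>

lemma constrained_minimizer_is_eigenvector:
  fixes V :: "'v set" and A :: "'v \<Rightarrow> 'v \<Rightarrow> real" and f :: "'v \<Rightarrow> real"
  assumes fin: "finite V"
    and sym: "\<And>x y. A x y = A y x"
    and ker: "\<And>x. x \<in> V \<Longrightarrow> (\<Sum>y\<in>V. A x y) = 0"
    and f0: "(\<Sum>x\<in>V. f x) = 0" and fne: "\<exists>x\<in>V. f x \<noteq> 0"
  obtains g \<mu> where "(\<Sum>x\<in>V. g x) = 0" "(\<Sum>x\<in>V. (g x)\<^sup>2) = 1"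
    "\<And>x. x \<in> V \<Longrightarrow> (\<Sum>y\<in>V. A x y * g y) = \<mu> * g x"
    "\<And>h. (\<Sum>x\<in>V. h x) = 0 \<Longrightarrow> \<mu> * (\<Sum>x\<in>V. (h x)\<^sup>2) \<le> (\<Sum>x\<in>V. \<Sum>y\<in>V. A x y * h x * h y)"
proof -
  define q where "q = (\<lambda>h :: 'v \<Rightarrow> real. \<Sum>x\<in>V. \<Sum>y\<in>V. A x y * h x * h y)"
  define K where "K = {g :: 'v \<Rightarrow> real. \<forall>x. if x \<in> V then \<bar>g x\<bar> \<le> 1 else g x = 0}
      \<inter> {g. (\<Sum>x\<in>V. g x) = 0} \<inter> {g. (\<Sum>x\<in>V. (g x)\<^sup>2) = 1}"
  have cl1: "closed {g :: 'v \<Rightarrow> real. (\<Sum>x\<in>V. g x) = 0}"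
    by (intro closed_Collect_eq continuous_intros continuous_on_product_coordinates)
  have cl2: "closed {g :: 'v \<Rightarrow> real. (\<Sum>x\<in>V. (g x)\<^sup>2) = 1}"
    by (intro closed_Collect_eq continuous_intros continuous_on_product_coordinates)
  have K: "compact K"
    unfolding K_def by (intro compact_Int_closed compact_cube cl1 cl2)
  have contq: "continuous_on K q"
    unfolding q_def
    by (intro continuous_intros continuous_on_subset[OF continuous_on_product_coordinates]) auto
  define N where "N = (\<lambda>h :: 'v \<Rightarrow> real. \<Sum>x\<in>V. (h x)\<^sup>2)"
  have Npos: "N h > 0" if "\<exists>x\<in>V. h x \<noteq> 0" for h
    using that fin unfolding N_def by (metis sum_pos2 zero_le_power2 zero_less_power2)
  define unit where "unit = (\<lambda>h x. if x \<in> V then h x / sqrt (N h) else 0 :: real)"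
  have unitK: "unit h \<in> K" and q_unit: "q (unit h) = q h / N h"
    if h: "(\<Sum>x\<in>V. h x) = 0" "\<exists>x\<in>V. h x \<noteq> 0" for h
  proof -
    have pos: "N h > 0" using Npos h by blast
    have "\<bar>h x\<bar> \<le> sqrt (N h)" if "x \<in> V" for x
    proof -
      have "(h x)\<^sup>2 \<le> N h"
        unfolding N_def using fin that by (intro member_le_sum) auto
      then show ?thesis using real_le_rsqrt by (metis power2_abs real_le_rsqrt)
    qed
    then have "\<bar>unit h x\<bar> \<le> 1" if "x \<in> V" for x
      using that pos by (simp add: unit_def divide_le_eq)
    moreover have "(\<Sum>x\<in>V. unit h x) = (\<Sum>x\<in>V. h x) / sqrt (N h)"
      by (simp add: unit_def sum_divide_distrib)
    moreover have "(\<Sum>x\<in>V. (unit h x)\<^sup>2) = (\<Sum>x\<in>V. (h x)\<^sup>2) / N h"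
      using pos by (simp add: unit_def power_divide sum_divide_distrib)
    ultimately show "unit h \<in> K"
      using h(1) pos by (auto simp: K_def N_def) (auto simp: unit_def)
    have "q (unit h) = (\<Sum>x\<in>V. \<Sum>y\<in>V. A x y * h x * h y / (sqrt (N h) * sqrt (N h)))"
      unfolding q_def by (intro sum.cong) (auto simp: unit_def)
    then show "q (unit h) = q h / N h"
      using pos by (simp add: q_def sum_divide_distrib)
  qed
  have "K \<noteq> {}" using unitK[OF f0 fne] by blast
  then obtain g where g: "g \<in> K" "\<And>h. h \<in> K \<Longrightarrow> q g \<le> q h"
    using continuous_attains_inf[OF K _ contq] by blast
  define \<mu> where "\<mu> = q g"
  have g0: "(\<Sum>x\<in>V. g x) = 0" and g1: "N g = 1"
    using g(1) by (auto simp: K_def N_def)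
  have min: "\<mu> * N h \<le> q h" if "(\<Sum>x\<in>V. h x) = 0" for h
  proof (cases "\<exists>x\<in>V. h x \<noteq> 0")
    case True
    have "\<mu> \<le> q h / N h"
      using g(2)[OF unitK[OF that True]] q_unit[OF that True] by (simp add: \<mu>_def)
    then show ?thesis using Npos[OF True] by (simp add: pos_le_divide_eq)
  next
    case False
    then show ?thesis by (simp add: N_def q_def)
  qed
  define r where "r = (\<lambda>x. (\<Sum>y\<in>V. A x y * g y) - \<mu> * g x)"
  have swap: "(\<Sum>x\<in>V. \<Sum>y\<in>V. A x y * g x * h y) = (\<Sum>x\<in>V. h x * (\<Sum>y\<in>V. A x y * g y))" for h :: "'v \<Rightarrow> real"
    by (subst sum.swap, subst sym) (simp add: sum_distrib_left mult_ac)
  have r0: "(\<Sum>x\<in>V. r x) = 0"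
  proof -
    have "(\<Sum>x\<in>V. \<Sum>y\<in>V. A x y * g y) = (\<Sum>y\<in>V. (\<Sum>x\<in>V. A y x) * g y)"
      by (subst sum.swap, subst sym) (simp add: sum_distrib_right)
    also have "\<dots> = 0" using ker by simp
    finally show ?thesis
      unfolding r_def by (simp add: sum_subtractf sum_distrib_left[symmetric] g0)
  qed
  \<comment> \<open>minimality of \<open>g\<close> against the competitor \<open>g + t r\<close>\<close>
  have var: "0 \<le> 2 * t * N r + t\<^sup>2 * (q r - \<mu> * N r)" for t
  proof -
    have "(\<Sum>x\<in>V. g x + t * r x) = 0"
      using g0 r0 by (simp add: sum.distrib sum_distrib_left[symmetric])
    from min[OF this] have "\<mu> * N (\<lambda>x. g x + t * r x) \<le> q (\<lambda>x. g x + t * r x)" .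
    moreover have "N (\<lambda>x. g x + t * r x) = N g + 2 * t * (\<Sum>x\<in>V. g x * r x) + t\<^sup>2 * N r"
      unfolding N_def sum_distrib_left sum.distrib[symmetric]
      by (intro sum.cong) (auto simp: power2_eq_square algebra_simps)
    moreover have "q (\<lambda>x. g x + t * r x)
        = q g + t * (\<Sum>x\<in>V. \<Sum>y\<in>V. A x y * g x * r y) + t * (\<Sum>x\<in>V. \<Sum>y\<in>V. A x y * r x * g y) + t\<^sup>2 * q r"
      unfolding q_def sum_distrib_left sum.distrib[symmetric]
      by (intro sum.cong refl) (auto simp: power2_eq_square algebra_simps)
    moreover have "(\<Sum>x\<in>V. \<Sum>y\<in>V. A x y * r x * g y) = (\<Sum>x\<in>V. r x * (\<Sum>y\<in>V. A x y * g y))"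
      by (simp add: sum_distrib_left mult_ac)
    moreover have "(\<Sum>x\<in>V. r x * (\<Sum>y\<in>V. A x y * g y)) = N r + \<mu> * (\<Sum>x\<in>V. g x * r x)"
      unfolding N_def sum_distrib_left[of \<mu>] sum.distrib[symmetric]
      by (intro sum.cong refl) (simp add: r_def power2_eq_square algebra_simps)
    ultimately show ?thesis
      using swap[of r] g1 by (simp add: \<mu>_def algebra_simps)
  qed
  have "N r = 0"
  proof (rule ccontr)
    assume "N r \<noteq> 0"
    moreover have "N r \<ge> 0" by (simp add: N_def sum_nonneg)
    ultimately have Nr: "N r > 0" by simp
    define b where "b = \<bar>q r - \<mu> * N r\<bar> + 1"
    have b: "b > 0" "q r - \<mu> * N r < b" by (auto simp: b_def)
    \<comment> \<open>a negative step small enough for the linear term to dominate the quadratic one\<close>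
    define t where "t = - N r / b"
    have "t\<^sup>2 * (q r - \<mu> * N r) \<le> t\<^sup>2 * b"
      using b by (intro mult_left_mono) auto
    then have "0 \<le> 2 * t * N r + t\<^sup>2 * b" using var[of t] by simp
    also have "\<dots> = - (N r)\<^sup>2 / b"
      using b by (simp add: t_def power2_eq_square field_simps)
    also have "\<dots> < 0" using Nr b by simp
    finally show False by simp
  qed
  then have "r x = 0" if "x \<in> V" for x
    using that Npos[of r] by (metis less_irrefl)
  then have eig: "(\<Sum>y\<in>V. A x y * g y) = \<mu> * g x" if "x \<in> V" for x
    using that by (simp add: r_def)
  show thesis
    by (rule that[of g \<mu>]) (use g0 g1 eig min in \<open>simp_all add: N_def q_def\<close>)
qed

lemma second_smallest_root_le:
  fixes p :: "real poly"
  assumes "p \<noteq> 0" "poly p a = 0" "poly p b = 0" "a < b"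
  shows "sorted_list_of_multiset (proots p) ! 1 \<le> b"
proof -
  let ?xs = "sorted_list_of_multiset (proots p)"
  have "a \<in> set ?xs" "b \<in> set ?xs"
    using assms by simp_all
  then obtain i j where ij: "i < length ?xs" "?xs ! i = a" "j < length ?xs" "?xs ! j = b"
    by (metis in_set_conv_nth)
  have "i < j"
    using ij assms(4) sorted_nth_mono[OF sorted_sorted_list_of_multiset, of j i "proots p"]
    by (cases "i < j") auto
  then show ?thesis
    using sorted_nth_mono[OF sorted_sorted_list_of_multiset, of 1 j "proots p"] ij by simp
qed

lemma graph_adj_sym: "graph_adj G x y \<longleftrightarrow> graph_adj G y x"
  by (auto simp: graph_adj_def insert_commute)

lemma laplacian_sym: "laplacian G x y = laplacian G y x"
  by (simp add: laplacian_def graph_adj_sym[of G x y])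

lemma sum_laplacian_mult:
  assumes "finite (fst G)" "x \<in> fst G"
  shows "(\<Sum>y\<in>fst G. laplacian G x y * f y) = (\<Sum>y | graph_adj G x y. f x - f y)"
proof -
  have fin: "finite {y. graph_adj G x y}"
    by (rule finite_subset[OF _ assms(1)]) (auto simp: graph_adj_def)
  have "(\<Sum>y\<in>fst G. laplacian G x y * f y)
      = (\<Sum>y\<in>fst G. (if y = x then real (graph_degree G x) * f x else 0)
           - (if graph_adj G x y then f y else 0))"
    by (intro sum.cong) (auto simp: laplacian_def graph_adj_def)
  also have "\<dots> = real (graph_degree G x) * f x - (\<Sum>y\<in>fst G. if graph_adj G x y then f y else 0)"
    using assms by (simp add: sum_subtractf)
  also have "(\<Sum>y\<in>fst G. if graph_adj G x y then f y else 0) = (\<Sum>y | graph_adj G x y. f y)"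
    by (rule sum.mono_neutral_cong_right) (use assms in \<open>auto simp: graph_adj_def\<close>)
  finally show ?thesis
    by (simp add: sum_subtractf graph_degree_def)
qed

lemma laplacian_quadratic_form:
  assumes "finite (fst G)"
  shows "(\<Sum>x\<in>fst G. \<Sum>y\<in>fst G. laplacian G x y * f x * f y)
      = (\<Sum>x\<in>fst G. \<Sum>y | graph_adj G x y. (f x - f y)\<^sup>2) / 2"
proof -
  let ?V = "fst G"
  let ?e = "\<lambda>F :: 'a \<Rightarrow> 'a \<Rightarrow> real. \<Sum>x\<in>?V. \<Sum>y\<in>?V. if graph_adj G x y then F x y else 0"
  have e: "(\<Sum>x\<in>?V. \<Sum>y | graph_adj G x y. F x y) = ?e F" for F
    by (intro sum.cong refl sum.mono_neutral_cong_left) (use assms in \<open>auto simp: graph_adj_def\<close>)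
  have e_swap: "?e (\<lambda>x y. F y x) = ?e F" for F
    by (subst sum.swap, intro sum.cong refl) (simp add: graph_adj_sym)
  have "(\<Sum>x\<in>?V. \<Sum>y\<in>?V. laplacian G x y * f x * f y)
      = (\<Sum>x\<in>?V. f x * (\<Sum>y\<in>?V. laplacian G x y * f y))"
    by (simp add: sum_distrib_left mult_ac)
  also have "\<dots> = (\<Sum>x\<in>?V. \<Sum>y | graph_adj G x y. f x * (f x - f y))"
    using assms by (simp add: sum_laplacian_mult sum_distrib_left)
  also have "\<dots> = ?e (\<lambda>x y. f x * (f x - f y))" by (rule e)
  finally have q: "(\<Sum>x\<in>?V. \<Sum>y\<in>?V. laplacian G x y * f x * f y) = ?e (\<lambda>x y. f x * (f x - f y))" .
  have "?e (\<lambda>x y. (f x - f y)\<^sup>2) = ?e (\<lambda>x y. f x * (f x - f y)) + ?e (\<lambda>x y. f y * (f y - f x))"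
    unfolding sum.distrib[symmetric]
    by (intro sum.cong refl) (auto simp: power2_eq_square algebra_simps)
  also have "?e (\<lambda>x y. f y * (f y - f x)) = ?e (\<lambda>x y. f x * (f x - f y))"
    by (rule e_swap)
  finally show ?thesis unfolding q e by simp
qed

lemma vertex_enum:
  assumes "finite (fst G)"
  shows "distinct (vertex_enum G)" "set (vertex_enum G) = fst G"
    "length (vertex_enum G) = card (fst G)"
proof -
  have "distinct (vertex_enum G) \<and> set (vertex_enum G) = fst G"
    unfolding vertex_enum_def by (rule someI_ex) (use finite_distinct_list[OF assms] in blast)
  then show "distinct (vertex_enum G)" "set (vertex_enum G) = fst G"
      "length (vertex_enum G) = card (fst G)"
    using distinct_card[of "vertex_enum G"] by auto
qed

lemma laplacian_eigenfunction_imp_root: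
  fixes g :: "'a \<Rightarrow> real"
  assumes fin: "finite (fst G)"
    and eig: "\<And>x. x \<in> fst G \<Longrightarrow> (\<Sum>y\<in>fst G. laplacian G x y * g y) = \<mu> * g x"
    and ne: "\<exists>x\<in>fst G. g x \<noteq> 0"
  shows "poly (char_poly (laplacian_mat G)) \<mu> = 0"
proof -
  let ?n = "card (fst G)" and ?v = "vertex_enum G"
  define w where "w = vec ?n (\<lambda>i. g (?v ! i))"
  note enum = vertex_enum[OF fin]
  have A: "laplacian_mat G \<in> carrier_mat ?n ?n" by (simp add: laplacian_mat_def)
  have bij: "bij_betw (\<lambda>i. ?v ! i) {0..<?n} (fst G)"
    by (rule bij_betw_nth) (use enum in auto)
  obtain x where x: "x \<in> fst G" "g x \<noteq> 0" using ne by blast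
  obtain i where i: "i < ?n" "?v ! i = x"
    using x(1) enum by (metis in_set_conv_nth)
  have "w \<noteq> 0\<^sub>v ?n"
    using i x(2) by (metis index_vec index_zero_vec(1) w_def)
  moreover have "laplacian_mat G *\<^sub>v w = \<mu> \<cdot>\<^sub>v w"
  proof (rule eq_vecI)
    fix i assume "i < dim_vec (\<mu> \<cdot>\<^sub>v w)"
    then have i: "i < ?n" by (simp add: w_def)
    then have vi: "?v ! i \<in> fst G" using enum by (metis nth_mem)
    have "(laplacian_mat G *\<^sub>v w) $ i = (\<Sum>j\<in>{0..<?n}. laplacian G (?v ! i) (?v ! j) * g (?v ! j))"
      using i by (simp add: laplacian_mat_def w_def scalar_prod_def)
    also have "\<dots> = (\<Sum>y\<in>fst G. laplacian G (?v ! i) y * g y)"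
      by (rule sum.reindex_bij_betw[OF bij])
    finally show "(laplacian_mat G *\<^sub>v w) $ i = (\<mu> \<cdot>\<^sub>v w) $ i"
      using i eig[OF vi] by (simp add: w_def)
  qed (simp add: laplacian_mat_def w_def)
  ultimately have "eigenvector (laplacian_mat G) w \<mu>"
    unfolding eigenvector_def using A by (simp add: w_def)
  then show ?thesis
    using eigenvalue_root_char_poly[OF A] unfolding eigenvalue_def by blast
qed

text \<open>
  Let \<open>\<mu>\<close> be the minimum of the Rayleigh quotient over mean-zero functions. It is an eigenvalue, and
  it is positive: the quadratic form is half the sum of \<open>(g x - g y)\<^sup>2\<close> over ordered adjacent pairs, so a
  minimiser with \<open>\<mu> = 0\<close> is constant on the connected graph, hence zero. Thus \<open>0 < \<mu>\<close> are two
  distinct roots of the characteristic polynomial, and the second entry of the sorted list of roots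
  is at most \<open>\<mu>\<close>.
\<close>

lemma spectral_gap_le_rayleigh:
  fixes f :: "'a \<Rightarrow> real"
  assumes fin: "finite (fst G)" and conn: "graph_connected G" and f0: "(\<Sum>x\<in>fst G. f x) = 0"
  shows "spectral_gap G * (\<Sum>x\<in>fst G. (f x)\<^sup>2)
      \<le> (\<Sum>x\<in>fst G. \<Sum>y\<in>fst G. laplacian G x y * f x * f y)"
proof (cases "\<exists>x\<in>fst G. f x \<noteq> 0")
  case True
  have row: "(\<Sum>y\<in>fst G. laplacian G x y) = 0" if "x \<in> fst G" for x
    using sum_laplacian_mult[OF fin that, of "\<lambda>_. 1"] by simp
  obtain g \<mu> where g: "(\<Sum>x\<in>fst G. g x) = 0" "(\<Sum>x\<in>fst G. (g x)\<^sup>2) = 1"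
    "\<And>x. x \<in> fst G \<Longrightarrow> (\<Sum>y\<in>fst G. laplacian G x y * g y) = \<mu> * g x"
    "\<And>h. (\<Sum>x\<in>fst G. h x) = 0 \<Longrightarrow>
      \<mu> * (\<Sum>x\<in>fst G. (h x)\<^sup>2) \<le> (\<Sum>x\<in>fst G. \<Sum>y\<in>fst G. laplacian G x y * h x * h y)"
    using constrained_minimizer_is_eigenvector[OF fin laplacian_sym row f0 True] by blast
  have "(\<Sum>x\<in>fst G. \<Sum>y\<in>fst G. laplacian G x y * g x * g y) = (\<Sum>x\<in>fst G. g x * (\<mu> * g x))"
    using g(3) by (simp add: sum_distrib_left[symmetric] mult.assoc mult.left_commute[of _ "g _"])
  also have "\<dots> = \<mu> * (\<Sum>x\<in>fst G. (g x)\<^sup>2)"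
    by (simp add: sum_distrib_left power2_eq_square mult_ac)
  finally have \<mu>: "\<mu> = (\<Sum>x\<in>fst G. \<Sum>y | graph_adj G x y. (g x - g y)\<^sup>2) / 2"
    unfolding laplacian_quadratic_form[OF fin] using g(2) by simp
  have gne: "\<exists>x\<in>fst G. g x \<noteq> 0"
    using g(2) by (metis (mono_tags, lifting) sum.neutral zero_neq_one zero_power2)
  have "\<mu> > 0"
  proof (rule ccontr)
    assume "\<not> \<mu> > 0"
    then have "(\<Sum>x\<in>fst G. \<Sum>y | graph_adj G x y. (g x - g y)\<^sup>2) \<le> 0" using \<mu> by simp
    then have z: "(\<Sum>x\<in>fst G. \<Sum>y | graph_adj G x y. (g x - g y)\<^sup>2) = 0"
      by (intro antisym sum_nonneg) auto
    have edge: "g x = g y" if "graph_adj G x y" for x y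
    proof -
      have fy: "finite {y. graph_adj G x y}"
        by (rule finite_subset[OF _ fin]) (auto simp: graph_adj_def)
      have "x \<in> fst G" using that by (simp add: graph_adj_def)
      then have "(\<Sum>y | graph_adj G x y. (g x - g y)\<^sup>2) = 0"
        using z fin by (subst (asm) sum_nonneg_eq_0_iff) (auto intro: sum_nonneg)
      then show ?thesis
        using that fy by (subst (asm) sum_nonneg_eq_0_iff) auto
    qed
    have path: "g x = g y" if "(graph_adj G)\<^sup>*\<^sup>* x y" for x y
      using that by induction (auto dest: edge)
    obtain x where x: "x \<in> fst G" "g x \<noteq> 0" using gne by blast
    have "g y = g x" if "y \<in> fst G" for y
      using path conn x(1) that unfolding graph_connected_def by metis
    then have "(\<Sum>y\<in>fst G. g y) = real (card (fst G)) * g x" by simp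
    then show False
      using g(1) x fin by auto
  qed
  have A: "laplacian_mat G \<in> carrier_mat (card (fst G)) (card (fst G))" by (simp add: laplacian_mat_def)
  have "char_poly (laplacian_mat G) \<noteq> 0"
    using degree_monic_char_poly[OF A] by auto
  moreover have "poly (char_poly (laplacian_mat G)) \<mu> = 0"
    by (rule laplacian_eigenfunction_imp_root[OF fin g(3) gne])
  moreover have "poly (char_poly (laplacian_mat G)) 0 = 0"
    by (rule laplacian_eigenfunction_imp_root[OF fin, of "\<lambda>_. 1"])
      (use row True in auto)
  ultimately have "spectral_gap G \<le> \<mu>"
    unfolding spectral_gap_def laplacian_eigenvalue_def
    using second_smallest_root_le[of "char_poly (laplacian_mat G)" 0 \<mu>] \<open>\<mu> > 0\<close> by simp
  then have "spectral_gap G * (\<Sum>x\<in>fst G. (f x)\<^sup>2) \<le> \<mu> * (\<Sum>x\<in>fst G. (f x)\<^sup>2)"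
    by (intro mult_right_mono sum_nonneg) auto
  then show ?thesis using g(4)[OF f0] by linarith
qed simp

section \<open>Sums over ordered simplices\<close>

lemma finite_ordered_simplices:
  assumes "finite V" "\<forall>s\<in>K. card s = m \<longrightarrow> s \<subseteq> V"
  shows "finite (ordered_simplices K m)"
proof (rule finite_subset)
  show "ordered_simplices K m \<subseteq> {xs. set xs \<subseteq> V \<and> length xs = m}"
    using assms(2) distinct_card by (force simp: ordered_simplices_def)
  show "finite {xs. set xs \<subseteq> V \<and> length xs = m}"
    using assms(1) by (rule finite_lists_length_eq)
qed

lemma bij_betw_move_to_front:
  assumes "i < m"
  shows "bij_betw (\<lambda>xs. xs ! i # del i xs) (ordered_simplices K m) (ordered_simplices K m)"
proof (rule bij_betw_byWitness[where f' = "\<lambda>ys. take i (tl ys) @ hd ys # drop i (tl ys)"])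
  let ?f = "\<lambda>xs :: 'a list. xs ! i # del i xs" and ?g = "\<lambda>ys :: 'a list. take i (tl ys) @ hd ys # drop i (tl ys)"
  show "\<forall>xs\<in>ordered_simplices K m. ?g (?f xs) = xs"
    using assms by (auto simp: ordered_simplices_def del_def min_def id_take_nth_drop[symmetric])
  show "\<forall>ys\<in>ordered_simplices K m. ?f (?g ys) = ys"
  proof
    fix ys assume "ys \<in> ordered_simplices K m"
    then have "length ys = m" by (simp add: ordered_simplices_def)
    then obtain z zs where "ys = z # zs" "i \<le> length zs" using assms by (cases ys) auto
    then show "?f (?g ys) = ys" by (simp add: del_def nth_append)
  qed
  have "mset (?f xs) = mset xs" if "length xs = m" for xs
  proof -
    have "mset xs = mset (take i xs @ xs ! i # drop (Suc i) xs)"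
      using assms that by (simp add: id_take_nth_drop[symmetric])
    then show ?thesis by (simp add: del_def)
  qed
  then have "?f xs \<in> ordered_simplices K m" if "xs \<in> ordered_simplices K m" for xs
    using ordered_simplices_permute[of "?f xs" xs K m] that
    by (simp only: ordered_simplices_def mem_Collect_eq)
  then show "?f ` ordered_simplices K m \<subseteq> ordered_simplices K m" by blast
  have "mset (?g ys) = mset ys" if len: "length ys = m" for ys
  proof -
    obtain z zs where "ys = z # zs" using assms len by (cases ys) auto
    moreover have "mset (take i zs) + mset (drop i zs) = mset zs"
      unfolding mset_append[symmetric] by simp
    ultimately show ?thesis by simp
  qed
  then have "?g xs \<in> ordered_simplices K m" if "xs \<in> ordered_simplices K m" for xs
    using ordered_simplices_permute[of "?g xs" xs K m] that
    by (simp only: ordered_simplices_def mem_Collect_eq)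
  then show "?g ` ordered_simplices K m \<subseteq> ordered_simplices K m" by blast
qed

text \<open>
  The set of ordered simplices is invariant under rearrangement, so averaging over the position that
  is moved to the front does not change a sum over it. All symmetrisation arguments below go
  through this lemma.
\<close>

lemma sum_move_to_front:
  fixes F :: "'a list \<Rightarrow> real"
  shows "(\<Sum>xs\<in>ordered_simplices K m. \<Sum>i<m. F (xs ! i # del i xs)) = real m * (\<Sum>xs\<in>ordered_simplices K m. F xs)"
proof -
  have "(\<Sum>xs\<in>ordered_simplices K m. \<Sum>i<m. F (xs ! i # del i xs))
      = (\<Sum>i<m. \<Sum>xs\<in>ordered_simplices K m. F (xs ! i # del i xs))"
    by (rule sum.swap)
  also have "\<dots> = (\<Sum>i<m. \<Sum>xs\<in>ordered_simplices K m. F xs)"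
    by (rule sum.cong[OF refl], rule sum.reindex_bij_betw[OF bij_betw_move_to_front]) simp
  finally show ?thesis by simp
qed

text \<open>
  The adjointness of the coboundary and the map that sums over the first vertex: paired with an
  antisymmetric function, each of the \<open>m\<close> terms of the alternating sum contributes the same.
\<close>

lemma sum_alt_sum_mult:
  assumes "antisymmetric \<theta>"
  shows "(\<Sum>xs\<in>ordered_simplices K m. alt_sum f xs * \<theta> xs)
      = real m * (\<Sum>xs\<in>ordered_simplices K m. f (tl xs) * \<theta> xs)"
proof -
  have "alt_sum f xs * \<theta> xs = (\<Sum>i<m. f (tl (xs ! i # del i xs)) * \<theta> (xs ! i # del i xs))"
    if "xs \<in> ordered_simplices K m" for xs
  proof -
    have "length xs = m" using that by (simp add: ordered_simplices_def)
    then show ?thesis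
      unfolding alt_sum_def sum_distrib_right
      by (intro sum.cong) (auto simp: antisymmetric_move_to_front[OF assms])
  qed
  then show ?thesis
    unfolding sum_move_to_front[where F = "\<lambda>xs. f (tl xs) * \<theta> xs", symmetric] by (intro sum.cong) auto
qed

text \<open>
  A link in an arbitrary family of sets, because it is also taken in the family of cliques that are
  not simplices, which is not a complex.
\<close>

definition vertex_link :: "'a set set \<Rightarrow> 'a \<Rightarrow> 'a set set" where
  "vertex_link K x = {s. x \<notin> s \<and> insert x s \<in> K}"

lemma Cons_in_ordered_simplices:
  "x # xs \<in> ordered_simplices K (Suc m) \<longleftrightarrow> xs \<in> ordered_simplices (vertex_link K x) m"
  by (auto simp: ordered_simplices_def vertex_link_def)

lemma sum_ordered_simplices_Suc:
  fixes F :: "'a list \<Rightarrow> real"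
  assumes "finite V" "\<forall>s\<in>K. card s = Suc m \<longrightarrow> s \<subseteq> V"
  shows "(\<Sum>xs\<in>ordered_simplices K (Suc m). F xs)
      = (\<Sum>x\<in>V. \<Sum>xs\<in>ordered_simplices (vertex_link K x) m. F (x # xs))"
proof -
  have inV: "set xs \<subseteq> V" if "xs \<in> ordered_simplices K (Suc m)" for xs
    using that assms(2) by (auto simp: ordered_simplices_def distinct_card)
  have fin: "finite (ordered_simplices K (Suc m))"
    by (rule finite_ordered_simplices[OF assms])
  have "finite (ordered_simplices (vertex_link K x) m)" for x
  proof -
    have "finite ((#) x ` ordered_simplices (vertex_link K x) m)"
      by (rule finite_subset[OF _ fin]) (auto simp: Cons_in_ordered_simplices)
    then show ?thesis by (rule finite_imageD) simp
  qed
  then have "(\<Sum>x\<in>V. \<Sum>xs\<in>ordered_simplices (vertex_link K x) m. F (x # xs))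
      = (\<Sum>(x, xs)\<in>Sigma V (\<lambda>x. ordered_simplices (vertex_link K x) m). F (x # xs))"
    using assms(1) by (intro sum.Sigma) auto
  also have "\<dots> = (\<Sum>xs\<in>ordered_simplices K (Suc m). F xs)"
  proof (rule sum.reindex_bij_witness[of _ "\<lambda>xs. (hd xs, tl xs)" "\<lambda>(x, xs). x # xs"])
    fix xs assume xs: "xs \<in> ordered_simplices K (Suc m)"
    then obtain y ys where ys: "xs = y # ys" by (cases xs) (auto simp: ordered_simplices_def)
    then show "(hd xs, tl xs) \<in> Sigma V (\<lambda>x. ordered_simplices (vertex_link K x) m)"
      using xs inV[OF xs] by (simp add: Cons_in_ordered_simplices)
    show "(case (hd xs, tl xs) of (x, xs) \<Rightarrow> x # xs) = xs" using ys by simp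
  qed (auto simp: Cons_in_ordered_simplices)
  finally show ?thesis by simp
qed

text \<open>
  Double counting: an ordered simplex \<open>xs\<close> occurs as the tail of a member of \<open>K\<close> once for each vertex
  that completes it.
\<close>

lemma sum_tl_eq_count:
  fixes g :: "'a list \<Rightarrow> real"
  assumes "finite V" "\<forall>s\<in>K. card s = Suc m \<longrightarrow> s \<subseteq> V"
    and fin: "finite (ordered_simplices X m)"
    and face: "\<And>x s. insert x s \<in> K \<Longrightarrow> x \<notin> s \<Longrightarrow> finite s \<Longrightarrow> card s = m \<Longrightarrow> s \<in> X"
  shows "(\<Sum>xs\<in>ordered_simplices K (Suc m). g (tl xs))
      = (\<Sum>xs\<in>ordered_simplices X m. real (card {x \<in> V. set xs \<in> vertex_link K x}) * g xs)"
proof -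
  have "ordered_simplices (vertex_link K x) m = {xs \<in> ordered_simplices X m. set xs \<in> vertex_link K x}" for x
    using face by (auto simp: ordered_simplices_def vertex_link_def distinct_card)
  then have "(\<Sum>xs\<in>ordered_simplices K (Suc m). g (tl xs))
      = (\<Sum>x\<in>V. \<Sum>xs\<in>ordered_simplices X m. if set xs \<in> vertex_link K x then g xs else 0)"
    unfolding sum_ordered_simplices_Suc[OF assms(1,2)] using fin by (simp add: sum.inter_filter)
  also have "\<dots> = (\<Sum>xs\<in>ordered_simplices X m. \<Sum>x\<in>V. if set xs \<in> vertex_link K x then g xs else 0)"
    by (rule sum.swap)
  also have "\<dots> = (\<Sum>xs\<in>ordered_simplices X m. real (card {x \<in> V. set xs \<in> vertex_link K x}) * g xs)"
    using assms(1) by (simp add: sum.inter_filter[symmetric])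
  finally show ?thesis .
qed

text \<open>
  Expanding \<open>\<parallel>d \<phi>\<parallel>\<^sup>2\<close> into its diagonal and its off-diagonal terms. Adjointness replaces one factor
  \<open>alt_sum \<phi> \<eta>\<close> by \<open>\<phi> (tl \<eta>)\<close>; unfolding the other one by its recursion isolates the square
  \<open>\<phi> (tl \<eta>)\<^sup>2\<close>, and adjointness inside the link of the first vertex \<open>x\<close> collects the remaining
  products.
\<close>

lemma sum_alt_sum_square_eq:
  fixes \<phi> :: "'a list \<Rightarrow> real"
  assumes "finite V" "\<forall>s\<in>K. card s = Suc (Suc k) \<longrightarrow> s \<subseteq> V" and anti: "antisymmetric \<phi>"
  shows "(\<Sum>\<eta>\<in>ordered_simplices K (Suc (Suc k)). (alt_sum \<phi> \<eta>)\<^sup>2)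
      = (real k + 2) * ((\<Sum>\<eta>\<in>ordered_simplices K (Suc (Suc k)). (\<phi> (tl \<eta>))\<^sup>2)
          - (real k + 1) * (\<Sum>x\<in>V. \<Sum>\<zeta>\<in>ordered_simplices (vertex_link K x) (Suc k). \<phi> (x # tl \<zeta>) * \<phi> \<zeta>))"
proof -
  note split = sum_ordered_simplices_Suc[OF assms(1,2)]
  let ?S = "\<lambda>x. ordered_simplices (vertex_link K x) (Suc k)"
  have "(\<Sum>\<eta>\<in>ordered_simplices K (Suc (Suc k)). (alt_sum \<phi> \<eta>)\<^sup>2)
      = (real k + 2) * (\<Sum>\<eta>\<in>ordered_simplices K (Suc (Suc k)). \<phi> (tl \<eta>) * alt_sum \<phi> \<eta>)"
    unfolding power2_eq_square sum_alt_sum_mult[OF antisymmetric_alt_sum[OF anti]] by simp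
  also have "(\<Sum>\<eta>\<in>ordered_simplices K (Suc (Suc k)). \<phi> (tl \<eta>) * alt_sum \<phi> \<eta>)
      = (\<Sum>x\<in>V. \<Sum>\<zeta>\<in>?S x. (\<phi> \<zeta>)\<^sup>2 - alt_sum (\<lambda>ys. \<phi> (x # ys)) \<zeta> * \<phi> \<zeta>)"
    unfolding split by (intro sum.cong refl) (simp add: power2_eq_square algebra_simps)
  also have "\<dots> = (\<Sum>x\<in>V. \<Sum>\<zeta>\<in>?S x. (\<phi> \<zeta>)\<^sup>2)
      - (\<Sum>x\<in>V. (real k + 1) * (\<Sum>\<zeta>\<in>?S x. \<phi> (x # tl \<zeta>) * \<phi> \<zeta>))"
    unfolding sum_subtractf sum_alt_sum_mult[OF anti] by (simp add: add.commute)
  also have "(\<Sum>x\<in>V. \<Sum>\<zeta>\<in>?S x. (\<phi> \<zeta>)\<^sup>2) = (\<Sum>\<eta>\<in>ordered_simplices K (Suc (Suc k)). (\<phi> (tl \<eta>))\<^sup>2)"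
    unfolding split by simp
  finally show ?thesis by (simp add: sum_distrib_left)
qed

text \<open>
  Cauchy-Schwarz on the \<open>m\<close> terms of each alternating sum gives one factor \<open>m\<close>, symmetrisation the
  other.
\<close>

lemma sum_alt_sum_square_le:
  fixes \<phi> :: "'a list \<Rightarrow> real"
  assumes anti: "antisymmetric \<phi>"
  shows "(\<Sum>\<eta>\<in>ordered_simplices K m. (alt_sum \<phi> \<eta>)\<^sup>2)
      \<le> (real m)\<^sup>2 * (\<Sum>\<eta>\<in>ordered_simplices K m. (\<phi> (tl \<eta>))\<^sup>2)"
proof -
  have "(alt_sum \<phi> \<eta>)\<^sup>2 \<le> real m * (\<Sum>i<m. (\<phi> (tl (\<eta> ! i # del i \<eta>)))\<^sup>2)"
    if "\<eta> \<in> ordered_simplices K m" for \<eta>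
  proof -
    have "length \<eta> = m" using that by (simp add: ordered_simplices_def)
    then have "(alt_sum \<phi> \<eta>)\<^sup>2 \<le> real m * (\<Sum>i<m. ((- 1) ^ i * \<phi> (del i \<eta>))\<^sup>2)"
      unfolding alt_sum_def using sum_squared_le_sum_of_squares[where I = "{..<m}" and f = "\<lambda>i. (- 1) ^ i * \<phi> (del i \<eta>)"]
      by (simp add: mult.commute)
    also have "(\<Sum>i<m. ((- 1) ^ i * \<phi> (del i \<eta>))\<^sup>2) = (\<Sum>i<m. (\<phi> (tl (\<eta> ! i # del i \<eta>)))\<^sup>2)"
      by (intro sum.cong) (auto simp: power_mult_distrib simp flip: power_mult)
    finally show ?thesis .
  qed
  then have "(\<Sum>\<eta>\<in>ordered_simplices K m. (alt_sum \<phi> \<eta>)\<^sup>2)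
      \<le> (\<Sum>\<eta>\<in>ordered_simplices K m. real m * (\<Sum>i<m. (\<phi> (tl (\<eta> ! i # del i \<eta>)))\<^sup>2))"
    by (rule sum_mono)
  also have "\<dots> = real m * (real m * (\<Sum>\<eta>\<in>ordered_simplices K m. (\<phi> (tl \<eta>))\<^sup>2))"
    unfolding sum_distrib_left[symmetric] sum_move_to_front[where F = "\<lambda>\<eta>. (\<phi> (tl \<eta>))\<^sup>2"] by simp
  finally show ?thesis by (simp add: power2_eq_square)
qed

lemma sum_hd_weight_eq:
  assumes anti: "antisymmetric \<phi>"
  shows "(real k + 1) * (\<Sum>\<sigma>\<in>ordered_simplices X (Suc k). d (hd \<sigma>) * (\<phi> \<sigma>)\<^sup>2)
    = (\<Sum>\<sigma>\<in>ordered_simplices X (Suc k). (\<Sum>x\<in>set \<sigma>. d x) * (\<phi> \<sigma>)\<^sup>2)"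
proof -
  have "(\<Sum>x\<in>set \<sigma>. d x) * (\<phi> \<sigma>)\<^sup>2
      = (\<Sum>i<Suc k. d (hd (\<sigma> ! i # del i \<sigma>)) * (\<phi> (\<sigma> ! i # del i \<sigma>))\<^sup>2)"
    if "\<sigma> \<in> ordered_simplices X (Suc k)" for \<sigma>
  proof -
    have \<sigma>: "distinct \<sigma>" "length \<sigma> = Suc k" using that by (auto simp: ordered_simplices_def)
    have "(\<Sum>x\<in>set \<sigma>. d x) = (\<Sum>i<Suc k. d (\<sigma> ! i))"
      by (rule sum.reindex_bij_betw[OF bij_betw_nth, symmetric]) (use \<sigma> in auto)
    moreover have "(\<phi> (\<sigma> ! i # del i \<sigma>))\<^sup>2 = (\<phi> \<sigma>)\<^sup>2" if "i < Suc k" for i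
      using antisymmetric_move_to_front[OF anti, of i \<sigma>] that \<sigma>(2)
      by (simp add: power_mult_distrib flip: power_mult)
    ultimately show ?thesis by (simp add: sum_distrib_right del: sum.lessThan_Suc)
  qed
  then have "(\<Sum>\<sigma>\<in>ordered_simplices X (Suc k). (\<Sum>x\<in>set \<sigma>. d x) * (\<phi> \<sigma>)\<^sup>2)
      = (\<Sum>\<sigma>\<in>ordered_simplices X (Suc k). \<Sum>i<Suc k. d (hd (\<sigma> ! i # del i \<sigma>)) * (\<phi> (\<sigma> ! i # del i \<sigma>))\<^sup>2)"
    by (rule sum.cong[OF refl])
  also have "\<dots> = real (Suc k) * (\<Sum>\<sigma>\<in>ordered_simplices X (Suc k). d (hd \<sigma>) * (\<phi> \<sigma>)\<^sup>2)"
    by (rule sum_move_to_front[where F = "\<lambda>\<sigma>. d (hd \<sigma>) * (\<phi> \<sigma>)\<^sup>2"])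
  finally show ?thesis by (simp add: add.commute)
qed

section \<open>The Laplacian forms of a cocycle\<close>

lemma finite_complex_vertices:
  assumes "finite_complex X"
  shows "finite (complex_vertices X)"
proof -
  have "finite ((\<lambda>v. {v}) ` complex_vertices X)"
    by (rule finite_subset[of _ X]) (use assms in \<open>auto simp: complex_vertices_def finite_complex_def\<close>)
  then show ?thesis by (rule finite_imageD) simp
qed

lemma simplex_subset_vertices:
  assumes "finite_complex X" "s \<in> X"
  shows "s \<subseteq> complex_vertices X"
  using assms by (auto simp: finite_complex_def complex_vertices_def)

lemma sum_supported_Suc:
  fixes F :: "'a list \<Rightarrow> real"
  assumes X: "finite_complex X" and supp: "\<And>xs. xs \<notin> ordered_simplices X (Suc m) \<Longrightarrow> F xs = 0"
  shows "(\<Sum>\<sigma>\<in>ordered_simplices X (Suc m). F \<sigma>)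
      = (\<Sum>\<tau>\<in>ordered_simplices X m. \<Sum>x\<in>complex_vertices X. F (x # \<tau>))"
proof -
  note fin = finite_complex_vertices[OF X]
  have "ordered_simplices (vertex_link X x) m \<subseteq> ordered_simplices X m" for x
    using X by (auto simp: ordered_simplices_def vertex_link_def finite_complex_def)
  moreover have "finite (ordered_simplices X m)"
    using finite_ordered_simplices[OF fin] simplex_subset_vertices[OF X] by blast
  ultimately have "(\<Sum>\<tau>\<in>ordered_simplices (vertex_link X x) m. F (x # \<tau>))
      = (\<Sum>\<tau>\<in>ordered_simplices X m. F (x # \<tau>))" for x
    using supp by (intro sum.mono_neutral_left) (auto simp: Cons_in_ordered_simplices[symmetric])
  then have "(\<Sum>\<sigma>\<in>ordered_simplices X (Suc m). F \<sigma>)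
      = (\<Sum>x\<in>complex_vertices X. \<Sum>\<tau>\<in>ordered_simplices X m. F (x # \<tau>))"
    using sum_ordered_simplices_Suc[OF fin, of X m F] simplex_subset_vertices[OF X] by simp
  then show ?thesis by (simp add: sum.swap[of _ "complex_vertices X"])
qed

text \<open>
  A vertex is adjacent to all \<open>k + 1\<close> elements of the clique exactly if it extends the clique, and to at
  most \<open>k\<close> of them otherwise. The vertices of the clique itself are of the second kind, as they are
  not adjacent to themselves.
\<close>

lemma sum_degree_clique_le:
  fixes G :: "'a graph"
  assumes fin: "finite (fst G)" and s: "s \<in> clique_complex G" and card: "card s = Suc k"
  shows "(\<Sum>x\<in>s. graph_degree G x)
      \<le> k * card (fst G) + card {v \<in> fst G. s \<in> vertex_link (clique_complex G) v}"
proof -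
  let ?V = "fst G" and ?C = "{v \<in> fst G. s \<in> vertex_link (clique_complex G) v}"
  have fs: "finite s" using s by (simp add: clique_complex_def)
  have count: "(\<Sum>x\<in>A. if P x then 1 else 0) = card {x \<in> A. P x}" if "finite A" for A :: "'a set" and P
    using sum.inter_filter[OF that, of "\<lambda>_. 1 :: nat" P] by simp
  have deg: "graph_degree G x = (\<Sum>v\<in>?V. if graph_adj G x v then 1 else 0)" for x
  proof -
    have "{y. graph_adj G x y} = {v \<in> ?V. graph_adj G x v}" by (auto simp: graph_adj_def)
    then show ?thesis using count[OF fin] by (simp add: graph_degree_def)
  qed
  have "(\<Sum>x\<in>s. graph_degree G x) = (\<Sum>v\<in>?V. card {x \<in> s. graph_adj G x v})"
    unfolding deg count[OF fs, symmetric] by (rule sum.swap)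
  moreover have "(\<Sum>v\<in>?V. card {x \<in> s. graph_adj G x v})
      \<le> (\<Sum>v\<in>?V. k + (if s \<in> vertex_link (clique_complex G) v then 1 else 0))"
  proof (rule sum_mono)
    fix v assume v: "v \<in> ?V"
    have le: "card {x \<in> s. graph_adj G x v} \<le> Suc k"
      using card_mono[OF fs, of "{x \<in> s. graph_adj G x v}"] card by auto
    show "card {x \<in> s. graph_adj G x v} \<le> k + (if s \<in> vertex_link (clique_complex G) v then 1 else 0)"
    proof (cases "\<forall>x\<in>s. graph_adj G x v")
      case True
      then have "v \<notin> s" by (auto simp: graph_adj_def)
      moreover have "\<forall>x\<in>s. graph_adj G v x" using True by (simp add: graph_adj_sym[of G v])
      then have "insert v s \<in> clique_complex G"
        using s v True by (auto simp: clique_complex_def)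
      ultimately show ?thesis using le by (simp add: vertex_link_def)
    next
      case False
      then have "{x \<in> s. graph_adj G x v} \<subset> s" by auto
      then have "card {x \<in> s. graph_adj G x v} < Suc k"
        unfolding card[symmetric] by (rule psubset_card_mono[OF fs])
      then show ?thesis by simp
    qed
  qed
  moreover have "(\<Sum>v\<in>?V. k + (if s \<in> vertex_link (clique_complex G) v then 1 else 0)) = k * card ?V + card ?C"
    unfolding sum.distrib count[OF fin] by (simp add: mult.commute)
  ultimately show ?thesis by linarith
qed

lemma one_skeleton_graph_vertices [simp]: "fst (one_skeleton_graph X) = complex_vertices X"
  by (simp add: one_skeleton_graph_def)

lemma simplex_iff_clique:
  assumes "complex_skeleton k X = complex_skeleton k (clique_complex (one_skeleton_graph X))" "card s \<le> k + 1"
  shows "s \<in> X \<longleftrightarrow> s \<in> clique_complex (one_skeleton_graph X)"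
  using assms unfolding complex_skeleton_def by blast

lemma clique_complex_subset: "t \<in> clique_complex G \<Longrightarrow> s \<subseteq> t \<Longrightarrow> s \<in> clique_complex G"
  unfolding clique_complex_def using finite_subset by blast

text \<open>
  A clique \<open>insert u s\<close> that is not a simplex witnesses \<open>u\<close> in the set counted by \<open>D_max\<close>: replacing
  an element of \<open>s\<close> by \<open>u\<close> gives a clique with \<open>k + 1\<close> elements, which is a simplex because the
  \<open>k\<close>-skeleta agree.
\<close>

lemma card_missing_cofaces_le_D_max:
  fixes X :: "'a set set" and k :: nat
  defines "Cl \<equiv> clique_complex (one_skeleton_graph X)"
  assumes X: "finite_complex X"
    and skel: "complex_skeleton k X = complex_skeleton k Cl"
    and s: "s \<in> X" "card s = Suc k"
  shows "card {u \<in> complex_vertices X. s \<in> vertex_link (Cl - X) u} \<le> D_max X k"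
proof -
  let ?D = "\<lambda>\<sigma>. {u \<in> complex_vertices X. {u} \<notin> complex_link X \<sigma> \<and> (\<forall>v\<in>\<sigma>. {u} \<in> complex_link X (\<sigma> - {v}))}"
  have fs: "finite s" using s(2) by (simp add: card_ge_0_finite)
  have "{u \<in> complex_vertices X. s \<in> vertex_link (Cl - X) u} \<subseteq> ?D s"
  proof safe
    fix u assume u: "u \<in> complex_vertices X" "s \<in> vertex_link (Cl - X) u"
    then have us: "u \<notin> s" "insert u s \<in> Cl" "insert u s \<notin> X" by (auto simp: vertex_link_def)
    { assume "{u} \<in> complex_link X s"
      then show False using us(3) by (simp add: complex_link_def) }
    fix v assume v: "v \<in> s"
    have "insert u (s - {v}) \<in> Cl"
      using us(2) unfolding Cl_def by (rule clique_complex_subset) blast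
    moreover have "card (insert u (s - {v})) \<le> k + 1"
      using fs s(2) us(1) v by simp
    ultimately have "insert u (s - {v}) \<in> X"
      using simplex_iff_clique[of k X] skel unfolding Cl_def by blast
    then show "{u} \<in> complex_link X (s - {v})"
      using u(1) us(1) by (simp add: complex_link_def complex_vertices_def)
  qed
  then have "card {u \<in> complex_vertices X. s \<in> vertex_link (Cl - X) u} \<le> card (?D s)"
    using finite_complex_vertices[OF X] by (intro card_mono) auto
  also have "\<dots> \<le> D_max X k"
    unfolding D_max_def
  proof (rule Max_ge)
    show "finite (insert 0 ((\<lambda>\<sigma>. card (?D \<sigma>)) ` complex_simplices X k))"
      using X by (simp add: complex_simplices_def finite_complex_def)
    show "card (?D s) \<in> insert 0 ((\<lambda>\<sigma>. card (?D \<sigma>)) ` complex_simplices X k)"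
      using s by (auto simp: complex_simplices_def)
  qed
  finally show ?thesis .
qed

lemma laplacian_form_split:
  assumes fin: "finite (fst G)"
  shows "(\<Sum>x\<in>fst G. \<Sum>y\<in>fst G. laplacian G x y * f x * f y)
    = (\<Sum>x\<in>fst G. real (graph_degree G x) * (f x)\<^sup>2)
      - (\<Sum>x\<in>fst G. \<Sum>y\<in>fst G. if graph_adj G x y then f x * f y else 0)"
  unfolding sum_subtractf[symmetric]
proof (rule sum.cong[OF refl])
  fix x assume x: "x \<in> fst G"
  have "(\<Sum>y\<in>fst G. laplacian G x y * f x * f y)
      = (\<Sum>y\<in>fst G. (if y = x then real (graph_degree G x) * (f x)\<^sup>2 else 0)
           - (if graph_adj G x y then f x * f y else 0))"
    by (intro sum.cong) (auto simp: laplacian_def graph_adj_def power2_eq_square)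
  then show "(\<Sum>y\<in>fst G. laplacian G x y * f x * f y)
      = real (graph_degree G x) * (f x)\<^sup>2 - (\<Sum>y\<in>fst G. if graph_adj G x y then f x * f y else 0)"
    using fin x by (simp add: sum_subtractf)
qed

text \<open>
  The off-diagonal terms of \<open>\<parallel>d \<phi>\<parallel>\<^sup>2\<close> over all cliques are the off-diagonal terms of the Laplacian
  forms of the functions \<open>u \<mapsto> \<phi> (u # \<tau>)\<close>: if \<open>x # \<tau>\<close> and \<open>y # \<tau>\<close> are simplices and \<open>x\<close>, \<open>y\<close> are adjacent,
  then \<open>x # y # \<tau>\<close> is a clique, whether or not it is a simplex. This is where summing over cliques
  instead of simplices matters.
\<close>

lemma sum_cross_terms:
  fixes X :: "'a set set" and \<phi> :: "'a list \<Rightarrow> real" and k :: nat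
  defines "G \<equiv> one_skeleton_graph X"
  defines "Cl \<equiv> clique_complex G"
  assumes X: "finite_complex X"
    and skel: "complex_skeleton k X = complex_skeleton k Cl"
    and supp: "\<And>xs. xs \<notin> ordered_simplices X (Suc k) \<Longrightarrow> \<phi> xs = 0"
  shows "(\<Sum>x\<in>complex_vertices X. \<Sum>\<zeta>\<in>ordered_simplices (vertex_link Cl x) (Suc k). \<phi> (x # tl \<zeta>) * \<phi> \<zeta>)
    = (\<Sum>\<tau>\<in>ordered_simplices X k. \<Sum>x\<in>complex_vertices X. \<Sum>y\<in>complex_vertices X.
         if graph_adj G x y then \<phi> (x # \<tau>) * \<phi> (y # \<tau>) else 0)"
proof -
  let ?V = "complex_vertices X" and ?L = "\<lambda>x y. ordered_simplices (vertex_link (vertex_link Cl x) y) k"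
  note fin = finite_complex_vertices[OF X]
  have ClV: "s \<subseteq> ?V" if "s \<in> Cl" for s
    using that by (auto simp: Cl_def G_def clique_complex_def)
  have finX: "finite (ordered_simplices X k)"
    using finite_ordered_simplices[OF fin] simplex_subset_vertices[OF X] by blast
  have iff: "s \<in> X \<longleftrightarrow> s \<in> Cl" if "card s \<le> k + 1" for s
    using simplex_iff_clique[of k X s] skel that unfolding Cl_def G_def by blast
  have "(\<Sum>\<zeta>\<in>ordered_simplices (vertex_link Cl x) (Suc k). \<phi> (x # tl \<zeta>) * \<phi> \<zeta>)
      = (\<Sum>y\<in>?V. \<Sum>\<tau>\<in>?L x y. \<phi> (x # \<tau>) * \<phi> (y # \<tau>))" for x
    using sum_ordered_simplices_Suc[OF fin, of "vertex_link Cl x" k "\<lambda>\<zeta>. \<phi> (x # tl \<zeta>) * \<phi> \<zeta>"] ClV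
    by (fastforce simp: vertex_link_def)
  moreover have "(\<Sum>\<tau>\<in>?L x y. \<phi> (x # \<tau>) * \<phi> (y # \<tau>))
      = (\<Sum>\<tau>\<in>ordered_simplices X k. if graph_adj G x y then \<phi> (x # \<tau>) * \<phi> (y # \<tau>) else 0)" for x y
  proof (rule sum.mono_neutral_cong_left[OF finX])
    have L: "distinct (x # y # \<tau>) \<and> insert x (insert y (set \<tau>)) \<in> Cl \<and> length \<tau> = k"
      if "\<tau> \<in> ?L x y" for \<tau>
      using that by (auto simp: ordered_simplices_def vertex_link_def insert_commute)
    show "?L x y \<subseteq> ordered_simplices X k"
    proof
      fix \<tau> assume "\<tau> \<in> ?L x y"
      note l = L[OF this]
      have "set \<tau> \<in> Cl" using l clique_complex_subset[of "insert x (insert y (set \<tau>))" G "set \<tau>"]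
        unfolding Cl_def by blast
      moreover have "card (set \<tau>) \<le> k + 1" using l card_length[of \<tau>] by simp
      ultimately show "\<tau> \<in> ordered_simplices X k" using l iff by (simp add: ordered_simplices_def)
    qed
    show "\<phi> (x # \<tau>) * \<phi> (y # \<tau>) = (if graph_adj G x y then \<phi> (x # \<tau>) * \<phi> (y # \<tau>) else 0)"
      if "\<tau> \<in> ?L x y" for \<tau>
      using L[OF that] by (auto simp: Cl_def clique_complex_def)
    show "\<forall>\<tau>\<in>ordered_simplices X k - ?L x y. (if graph_adj G x y then \<phi> (x # \<tau>) * \<phi> (y # \<tau>) else 0) = 0"
    proof (rule ballI, rule ccontr)
      fix \<tau> assume \<tau>: "\<tau> \<in> ordered_simplices X k - ?L x y"
        and "(if graph_adj G x y then \<phi> (x # \<tau>) * \<phi> (y # \<tau>) else 0) \<noteq> 0"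
      then have adj: "graph_adj G x y" and "\<phi> (x # \<tau>) \<noteq> 0" "\<phi> (y # \<tau>) \<noteq> 0"
        by (auto split: if_splits)
      then have xt: "x # \<tau> \<in> ordered_simplices X (Suc k)" and yt: "y # \<tau> \<in> ordered_simplices X (Suc k)"
        using supp by blast+
      have cl: "set zs \<in> Cl" if "zs \<in> ordered_simplices X (Suc k)" for zs
        using that iff[of "set zs"] by (simp add: ordered_simplices_def distinct_card)
      have "set (x # \<tau>) \<in> Cl" "set (y # \<tau>) \<in> Cl" using cl xt yt by blast+
      moreover have adj': "graph_adj G y x" using adj graph_adj_sym[of G x y] by blast
      ultimately have "insert x (insert y (set \<tau>)) \<in> Cl"
        using adj adj' unfolding Cl_def clique_complex_def by auto
      moreover have "x \<noteq> y" using adj by (simp add: graph_adj_def)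
      ultimately have "\<tau> \<in> ?L x y"
        using xt yt by (simp add: ordered_simplices_def vertex_link_def insert_commute)
      then show False using \<tau> by simp
    qed
  qed
  ultimately have "(\<Sum>x\<in>?V. \<Sum>\<zeta>\<in>ordered_simplices (vertex_link Cl x) (Suc k). \<phi> (x # tl \<zeta>) * \<phi> \<zeta>)
    = (\<Sum>x\<in>?V. \<Sum>y\<in>?V. \<Sum>\<tau>\<in>ordered_simplices X k. if graph_adj G x y then \<phi> (x # \<tau>) * \<phi> (y # \<tau>) else 0)"
    by simp
  also have "\<dots> = (\<Sum>x\<in>?V. \<Sum>\<tau>\<in>ordered_simplices X k. \<Sum>y\<in>?V. if graph_adj G x y then \<phi> (x # \<tau>) * \<phi> (y # \<tau>) else 0)"
    by (rule sum.cong[OF refl], rule sum.swap)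
  also have "\<dots> = (\<Sum>\<tau>\<in>ordered_simplices X k. \<Sum>x\<in>?V. \<Sum>y\<in>?V. if graph_adj G x y then \<phi> (x # \<tau>) * \<phi> (y # \<tau>) else 0)"
    by (rule sum.swap)
  finally show ?thesis .
qed

text \<open>
  Write \<open>n\<close> for the number of vertices, \<open>N\<close> for \<open>\<parallel>\<phi>\<parallel>\<^sup>2\<close>, \<open>c \<sigma>\<close> for the number of vertices that extend \<open>\<sigma>\<close> to a larger clique, and \<open>B\<close>
  and \<open>C\<close> for the diagonal and off-diagonal part of the left side. The clique degree bound gives
  \<open>(k + 1) B \<le> k n N + \<Sum> c \<sigma> (\<phi> \<sigma>)\<^sup>2\<close>. The sum of \<open>(d \<phi>)\<^sup>2\<close> over all \<open>(k + 2)\<close>-cliques equals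
  \<open>(k + 2) (\<Sum> c \<sigma> (\<phi> \<sigma>)\<^sup>2 - (k + 1) C)\<close>; a cocycle leaves only the cliques that are not simplices,
  and there are at most \<open>D_max X k\<close> of them over each \<open>\<sigma>\<close>. In \<open>(k + 1) (B - C)\<close> the sums weighted by
  \<open>c\<close> cancel.
\<close>

lemma cocycle_laplacian_bound:
  fixes X :: "'a set set" and \<phi> :: "'a list \<Rightarrow> real" and k :: nat
  defines "G \<equiv> one_skeleton_graph X"
  assumes X: "finite_complex X"
    and skel: "complex_skeleton k X = complex_skeleton k (clique_complex G)"
    and \<phi>: "\<phi> \<in> reduced_cocycles X k"
  shows "(real k + 1) * (\<Sum>\<tau>\<in>ordered_simplices X k. \<Sum>x\<in>complex_vertices X. \<Sum>y\<in>complex_vertices X.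
          laplacian G x y * \<phi> (x # \<tau>) * \<phi> (y # \<tau>))
    \<le> (real k * real (card (complex_vertices X)) + (real k + 2) * real (D_max X k))
        * (\<Sum>\<sigma>\<in>ordered_simplices X (Suc k). (\<phi> \<sigma>)\<^sup>2)"
proof -
  define Cl where "Cl = clique_complex G"
  define D where "D = real (D_max X k)"
  let ?V = "complex_vertices X" and ?S = "ordered_simplices X (Suc k)"
  note fin = finite_complex_vertices[OF X]
  have V: "fst G = ?V" by (simp add: G_def)
  have anti: "antisymmetric \<phi>" and supp: "\<And>xs. xs \<notin> ?S \<Longrightarrow> \<phi> xs = 0"
    and cocycle: "\<And>xs. coboundary X (k + 1) \<phi> xs = 0"
    using \<phi> by (auto simp: reduced_cocycles_def cochains_iff)
  have ClV: "s \<subseteq> ?V" if "s \<in> Cl" for s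
    using that by (auto simp: Cl_def G_def clique_complex_def)
  have finS: "finite ?S"
    using finite_ordered_simplices[OF fin] simplex_subset_vertices[OF X] by blast
  have finCl: "finite (ordered_simplices Cl m)" for m
    using finite_ordered_simplices[OF fin] ClV by blast
  have iff: "s \<in> X \<longleftrightarrow> s \<in> Cl" if "card s \<le> k + 1" for s
    using simplex_iff_clique[of k X s] skel that unfolding Cl_def G_def by blast
  have face: "s \<in> X" if "insert x s \<in> Cl" "card s = Suc k" for x s
    using that clique_complex_subset[of "insert x s" G s] iff[of s] by (auto simp: Cl_def)
  define c where "c = (\<lambda>\<sigma>. real (card {u \<in> ?V. set \<sigma> \<in> vertex_link Cl u}))"
  define N where "N = (\<Sum>\<sigma>\<in>?S. (\<phi> \<sigma>)\<^sup>2)"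
  define A where "A = (\<Sum>\<sigma>\<in>?S. c \<sigma> * (\<phi> \<sigma>)\<^sup>2)"
  define C where "C = (\<Sum>\<tau>\<in>ordered_simplices X k. \<Sum>x\<in>?V. \<Sum>y\<in>?V.
         if graph_adj G x y then \<phi> (x # \<tau>) * \<phi> (y # \<tau>) else 0)"
  define B where "B = (\<Sum>\<sigma>\<in>?S. real (graph_degree G (hd \<sigma>)) * (\<phi> \<sigma>)\<^sup>2)"

  have Q: "(\<Sum>\<tau>\<in>ordered_simplices X k. \<Sum>x\<in>?V. \<Sum>y\<in>?V. laplacian G x y * \<phi> (x # \<tau>) * \<phi> (y # \<tau>)) = B - C"
  proof -
    have "(\<Sum>x\<in>?V. \<Sum>y\<in>?V. laplacian G x y * \<phi> (x # \<tau>) * \<phi> (y # \<tau>))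
        = (\<Sum>x\<in>?V. real (graph_degree G x) * (\<phi> (x # \<tau>))\<^sup>2)
          - (\<Sum>x\<in>?V. \<Sum>y\<in>?V. if graph_adj G x y then \<phi> (x # \<tau>) * \<phi> (y # \<tau>) else 0)" for \<tau>
      using laplacian_form_split[of G "\<lambda>x. \<phi> (x # \<tau>)"] fin unfolding V by blast
    moreover have "B = (\<Sum>\<tau>\<in>ordered_simplices X k. \<Sum>x\<in>?V. real (graph_degree G x) * (\<phi> (x # \<tau>))\<^sup>2)"
      unfolding B_def
      by (subst sum_supported_Suc[OF X]) (simp_all add: supp)
    ultimately show ?thesis
      by (simp add: C_def sum_subtractf)
  qed

  have degrees: "(real k + 1) * B \<le> real k * real (card ?V) * N + A"
  proof -
    have "(real k + 1) * B = (\<Sum>\<sigma>\<in>?S. (\<Sum>x\<in>set \<sigma>. real (graph_degree G x)) * (\<phi> \<sigma>)\<^sup>2)"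
      unfolding B_def by (rule sum_hd_weight_eq[OF anti])
    also have "\<dots> \<le> (\<Sum>\<sigma>\<in>?S. (real k * real (card ?V) + c \<sigma>) * (\<phi> \<sigma>)\<^sup>2)"
    proof (intro sum_mono mult_right_mono)
      fix \<sigma> assume "\<sigma> \<in> ?S"
      then have \<sigma>: "set \<sigma> \<in> X" "card (set \<sigma>) = Suc k"
        by (auto simp: ordered_simplices_def distinct_card)
      then have "set \<sigma> \<in> Cl" using iff[of "set \<sigma>"] by simp
      then have "(\<Sum>x\<in>set \<sigma>. graph_degree G x) \<le> k * card ?V + card {u \<in> ?V. set \<sigma> \<in> vertex_link Cl u}"
        using sum_degree_clique_le[of G "set \<sigma>" k] \<sigma>(2) fin unfolding V Cl_def by blast
      then have "real (\<Sum>x\<in>set \<sigma>. graph_degree G x)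
          \<le> real (k * card ?V + card {u \<in> ?V. set \<sigma> \<in> vertex_link Cl u})"
        by (rule of_nat_mono)
      then show "(\<Sum>x\<in>set \<sigma>. real (graph_degree G x)) \<le> real k * real (card ?V) + c \<sigma>"
        by (simp add: c_def)
    qed simp
    also have "\<dots> = real k * real (card ?V) * N + A"
      by (simp add: N_def A_def distrib_right sum.distrib sum_distrib_left)
    finally show ?thesis .
  qed

  have identity: "(\<Sum>\<eta>\<in>ordered_simplices Cl (Suc (Suc k)). (alt_sum \<phi> \<eta>)\<^sup>2) = (real k + 2) * (A - (real k + 1) * C)"
  proof -
    have "(\<Sum>\<eta>\<in>ordered_simplices Cl (Suc (Suc k)). (\<phi> (tl \<eta>))\<^sup>2) = A"
      unfolding A_def c_def
      by (rule sum_tl_eq_count[OF fin _ finS]) (use ClV face in auto)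
    moreover have "(\<Sum>x\<in>?V. \<Sum>\<zeta>\<in>ordered_simplices (vertex_link Cl x) (Suc k). \<phi> (x # tl \<zeta>) * \<phi> \<zeta>) = C"
      unfolding C_def Cl_def G_def
      by (rule sum_cross_terms[OF X _ supp]) (use skel in \<open>simp add: G_def\<close>)
    ultimately show ?thesis
      using sum_alt_sum_square_eq[OF fin _ anti, of Cl k] ClV by simp
  qed

  have missing: "(\<Sum>\<eta>\<in>ordered_simplices Cl (Suc (Suc k)). (alt_sum \<phi> \<eta>)\<^sup>2) \<le> (real k + 2)\<^sup>2 * (D * N)"
  proof -
    have "alt_sum \<phi> \<eta> = 0" if "\<eta> \<in> ordered_simplices Cl (Suc (Suc k)) - ordered_simplices (Cl - X) (Suc (Suc k))" for \<eta>
    proof -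
      have "\<eta> \<in> ordered_simplices X (k + 1 + 1)" using that by (auto simp: ordered_simplices_def)
      then show ?thesis using cocycle[of \<eta>] by (simp add: coboundary_alt_sum)
    qed
    then have "(\<Sum>\<eta>\<in>ordered_simplices Cl (Suc (Suc k)). (alt_sum \<phi> \<eta>)\<^sup>2)
        = (\<Sum>\<eta>\<in>ordered_simplices (Cl - X) (Suc (Suc k)). (alt_sum \<phi> \<eta>)\<^sup>2)"
      by (intro sum.mono_neutral_right finCl) (auto simp: ordered_simplices_def)
    also have "\<dots> \<le> (real (Suc (Suc k)))\<^sup>2 * (\<Sum>\<eta>\<in>ordered_simplices (Cl - X) (Suc (Suc k)). (\<phi> (tl \<eta>))\<^sup>2)"
      by (rule sum_alt_sum_square_le[OF anti])
    also have "(\<Sum>\<eta>\<in>ordered_simplices (Cl - X) (Suc (Suc k)). (\<phi> (tl \<eta>))\<^sup>2)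
        = (\<Sum>\<sigma>\<in>?S. real (card {u \<in> ?V. set \<sigma> \<in> vertex_link (Cl - X) u}) * (\<phi> \<sigma>)\<^sup>2)"
      by (rule sum_tl_eq_count[OF fin _ finS]) (use ClV face in auto)
    also have "\<dots> \<le> (\<Sum>\<sigma>\<in>?S. D * (\<phi> \<sigma>)\<^sup>2)"
    proof (intro sum_mono mult_right_mono)
      fix \<sigma> assume "\<sigma> \<in> ?S"
      then have \<sigma>: "set \<sigma> \<in> X" "card (set \<sigma>) = Suc k"
        by (auto simp: ordered_simplices_def distinct_card)
      then show "real (card {u \<in> ?V. set \<sigma> \<in> vertex_link (Cl - X) u}) \<le> D"
        using card_missing_cofaces_le_D_max[OF X _ \<sigma>] skel unfolding D_def Cl_def G_def by simp
    qed simp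
    finally show ?thesis
      by (simp add: N_def sum_distrib_left add.commute mult_left_mono)
  qed

  have "(real k + 2) * (A - (real k + 1) * C) \<le> (real k + 2) * ((real k + 2) * (D * N))"
    using missing unfolding identity by (simp add: power2_eq_square mult.assoc)
  then have "A - (real k + 1) * C \<le> (real k + 2) * (D * N)"
    by (rule mult_left_le_imp_le) simp
  then have "(real k + 1) * (B - C) \<le> (real k * real (card ?V) + (real k + 2) * D) * N"
    using degrees by (simp add: algebra_simps)
  then show ?thesis
    unfolding Q N_def D_def .
qed

section \<open>Coclosed representatives and the quotient group\<close>

text \<open>
  Orthogonal projection, by induction on the coordinates \<open>S\<close>. If some \<open>b \<in> W\<close> has a nonzero
  coordinate at the new index \<open>a\<close>, then \<open>W\<close> is spanned by its hyperplane \<open>W'\<close> of elements vanishing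
  at \<open>a\<close> and by \<open>b\<close> minus its projection to \<open>W'\<close>; this second vector is orthogonal to \<open>W'\<close> and has
  positive norm because its coordinate at \<open>a\<close> is that of \<open>b\<close>.
\<close>

lemma orthogonal_projection_exists:
  fixes W :: "('b \<Rightarrow> real) set" and S :: "'b set"
  assumes "finite S"
    and "\<And>a b v w. v \<in> W \<Longrightarrow> w \<in> W \<Longrightarrow> (\<lambda>s. a * v s + b * w s) \<in> W"
    and "W \<noteq> {}"
  shows "\<exists>w\<in>W. \<forall>v\<in>W. (\<Sum>s\<in>S. (\<phi> s - w s) * v s) = 0"
  using assms
proof (induction S arbitrary: W \<phi> rule: finite_induct)
  case empty
  then show ?case by auto
next
  case (insert a S)
  let ?ip = "\<lambda>f g. \<Sum>s\<in>insert a S. f s * g s :: real"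
  have lin: "(\<lambda>s. v s + c * w s) \<in> W" if "v \<in> W" "w \<in> W" for v w c
    using insert.prems(1)[OF that, of 1 c] by simp
  have "(\<lambda>s. 0) \<in> W"
    using insert.prems(2) insert.prems(1)[of _ _ 0 0] by auto
  define W' where "W' = {w \<in> W. w a = 0}"
  have "W' \<noteq> {}"
    using \<open>(\<lambda>s. 0) \<in> W\<close> by (auto simp: W'_def)
  have proj: "\<exists>w\<in>W'. \<forall>v\<in>W'. ?ip (\<lambda>s. \<psi> s - w s) v = 0" for \<psi> :: "'b \<Rightarrow> real"
  proof -
    have "\<exists>w\<in>W'. \<forall>v\<in>W'. (\<Sum>s\<in>S. (\<psi> s - w s) * v s) = 0"
      using insert.prems(1) \<open>W' \<noteq> {}\<close> by (intro insert.IH) (auto simp: W'_def)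
    moreover have "?ip (\<lambda>s. \<psi> s - w s) v = (\<Sum>s\<in>S. (\<psi> s - w s) * v s)" if "v \<in> W'" for w v
      using insert.hyps that by (simp add: W'_def)
    ultimately show ?thesis by auto
  qed
  obtain p where p: "p \<in> W'" "\<And>v. v \<in> W' \<Longrightarrow> ?ip (\<lambda>s. \<phi> s - p s) v = 0"
    using proj[of \<phi>] by blast
  show ?case
  proof (cases "W' = W")
    case True
    then show ?thesis using p by blast
  next
    case False
    then obtain b where b: "b \<in> W" "b a \<noteq> 0" by (auto simp: W'_def)
    obtain q where q: "q \<in> W'" "\<And>v. v \<in> W' \<Longrightarrow> ?ip (\<lambda>s. b s - q s) v = 0"
      using proj[of b] by blast
    define e where "e = (\<lambda>s. b s - q s)"
    have eW: "e \<in> W"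
      using lin[OF b(1), of q "- 1"] q(1) by (simp add: e_def W'_def)
    have ea: "e a \<noteq> 0"
      using b q(1) by (simp add: e_def W'_def)
    have pos: "?ip e e > 0"
      using ea insert.hyps(1) by (intro sum_pos2[of _ a]) (auto simp: zero_less_mult_iff linorder_neq_iff)
    define c where "c = ?ip (\<lambda>s. \<phi> s - p s) e / ?ip e e"
    define w where "w = (\<lambda>s. p s + c * e s)"
    have split: "?ip (\<lambda>s. \<phi> s - w s) v = ?ip (\<lambda>s. \<phi> s - p s) v - c * ?ip e v" for v
      unfolding w_def sum_distrib_left sum_subtractf[symmetric]
      by (intro sum.cong) (auto simp: algebra_simps)
    have orth': "?ip (\<lambda>s. \<phi> s - w s) v = 0" if "v \<in> W'" for v
      using p(2)[OF that] q(2)[OF that] unfolding split by (simp add: e_def)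
    have orthe: "?ip (\<lambda>s. \<phi> s - w s) e = 0"
      unfolding split c_def using pos by simp
    have "?ip (\<lambda>s. \<phi> s - w s) v = 0" if v: "v \<in> W" for v
    proof -
      define t where "t = v a / e a"
      define v' where "v' = (\<lambda>s. v s + (- t) * e s)"
      have "v' \<in> W'"
        using lin[OF v eW, of "- t"] ea by (simp add: W'_def v'_def t_def)
      moreover have "?ip (\<lambda>s. \<phi> s - w s) v
          = ?ip (\<lambda>s. \<phi> s - w s) v' + t * ?ip (\<lambda>s. \<phi> s - w s) e"
        unfolding sum_distrib_left sum.distrib[symmetric]
        by (intro sum.cong) (auto simp: v'_def algebra_simps)
      ultimately show ?thesis using orth' orthe by simp
    qed
    moreover have "w \<in> W"
      using lin[of p e c] p(1) eW by (simp add: w_def W'_def)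
    ultimately show ?thesis by blast
  qed
qed

text \<open>
  Subtract from \<open>\<phi>\<close> its orthogonal projection to the coboundaries, to get \<open>\<theta>\<close>. Then \<open>\<theta>\<close> is orthogonal to
  the coboundary of \<open>\<chi> \<tau> = \<Sum>\<^sub>u \<theta> (u # \<tau>)\<close>, which is itself a cochain; by adjointness the inner product is
  \<open>k + 1\<close> times \<open>\<parallel>\<chi>\<parallel>\<^sup>2\<close>, so \<open>\<chi> = 0\<close>.
\<close>

lemma exists_coclosed_representative:
  fixes X :: "'a set set"
  assumes X: "finite_complex X" and \<phi>: "\<phi> \<in> cochains X (k + 1)"
  obtains \<psi> where "\<psi> \<in> cochains X k"
    "\<And>\<tau>. (\<Sum>u\<in>complex_vertices X. \<phi> (u # \<tau>) - coboundary X k \<psi> (u # \<tau>)) = 0"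
proof -
  let ?V = "complex_vertices X"
  define W where "W = coboundary X k ` cochains X k"
  note fin = finite_complex_vertices[OF X]
  have finS: "finite (ordered_simplices X m)" for m
    using finite_ordered_simplices[OF fin] simplex_subset_vertices[OF X] by blast
  have "\<exists>w\<in>W. \<forall>v\<in>W. (\<Sum>\<sigma>\<in>ordered_simplices X (k + 1). (\<phi> \<sigma> - w \<sigma>) * v \<sigma>) = 0"
  proof (rule orthogonal_projection_exists[OF finS])
    fix a b v w assume "v \<in> W" "w \<in> W"
    then obtain f g where "f \<in> cochains X k" "v = coboundary X k f" "g \<in> cochains X k" "w = coboundary X k g"
      by (auto simp: W_def)
    then show "(\<lambda>s. a * v s + b * w s) \<in> W"
      unfolding W_def using cochains_linear_combination[of f X k g a b]
      by (simp flip: coboundary_linear_combination)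
  next
    have "(\<lambda>_. 0) \<in> cochains X k" by (simp add: cochains_def)
    then show "W \<noteq> {}" unfolding W_def by blast
  qed
  then obtain \<psi> where \<psi>: "\<psi> \<in> cochains X k"
    and orth: "\<And>v. v \<in> W \<Longrightarrow> (\<Sum>\<sigma>\<in>ordered_simplices X (k + 1). (\<phi> \<sigma> - coboundary X k \<psi> \<sigma>) * v \<sigma>) = 0"
    unfolding W_def by blast
  define \<theta> where "\<theta> = (\<lambda>\<sigma>. \<phi> \<sigma> - coboundary X k \<psi> \<sigma>)"
  have \<theta>: "\<theta> xs = 0" if "xs \<notin> ordered_simplices X (Suc k)" for xs
    using \<phi> coboundary_in_cochains[OF \<psi>] that by (simp add: cochains_iff \<theta>_def)
  have anti: "antisymmetric \<theta>"
    using antisymmetric_linear_combination[of \<phi> "coboundary X k \<psi>" 1 "- 1"] \<phi> coboundary_in_cochains[OF \<psi>]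
    by (simp add: cochains_iff \<theta>_def)
  define \<chi> where "\<chi> = (\<lambda>\<tau>. \<Sum>u\<in>?V. \<theta> (u # \<tau>))"
  have "antisymmetric \<chi>"
    unfolding antisymmetric_def
  proof (intro allI)
    fix as x y bs
    have "\<theta> (u # as @ y # x # bs) = - \<theta> (u # as @ x # y # bs)" for u
      using antisymmetricD[OF anti, of "u # as" y x bs] by simp
    then show "\<chi> (as @ y # x # bs) = - \<chi> (as @ x # y # bs)"
      by (simp add: \<chi>_def sum_negf)
  qed
  moreover have \<chi>0: "\<chi> \<tau> = 0" if "\<tau> \<notin> ordered_simplices X k" for \<tau>
  proof -
    have "u # \<tau> \<notin> ordered_simplices X (k + 1)" for u
      using that del_in_ordered_simplices[OF X, of "u # \<tau>" k 0] by auto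
    then show ?thesis by (simp add: \<chi>_def \<theta>)
  qed
  ultimately have \<chi>: "\<chi> \<in> cochains X k" by (simp add: cochains_iff)
  have "0 = (\<Sum>\<sigma>\<in>ordered_simplices X (k + 1). \<theta> \<sigma> * coboundary X k \<chi> \<sigma>)"
    using orth[of "coboundary X k \<chi>"] \<chi> by (simp add: W_def \<theta>_def)
  also have "\<dots> = (\<Sum>\<sigma>\<in>ordered_simplices X (Suc k). alt_sum \<chi> \<sigma> * \<theta> \<sigma>)"
    by (simp add: coboundary_alt_sum mult.commute)
  also have "\<dots> = (real k + 1) * (\<Sum>\<sigma>\<in>ordered_simplices X (Suc k). \<chi> (tl \<sigma>) * \<theta> \<sigma>)"
    using sum_alt_sum_mult[OF anti, of \<chi> X "Suc k"] by (simp add: add.commute)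
  also have "(\<Sum>\<sigma>\<in>ordered_simplices X (Suc k). \<chi> (tl \<sigma>) * \<theta> \<sigma>) = (\<Sum>\<tau>\<in>ordered_simplices X k. (\<chi> \<tau>)\<^sup>2)"
  proof (subst sum_supported_Suc[OF X])
    show "(\<Sum>\<tau>\<in>ordered_simplices X k. \<Sum>x\<in>?V. \<chi> (tl (x # \<tau>)) * \<theta> (x # \<tau>)) = (\<Sum>\<tau>\<in>ordered_simplices X k. (\<chi> \<tau>)\<^sup>2)"
      by (simp add: power2_eq_square sum_distrib_left[symmetric]) (simp add: \<chi>_def)
  qed (simp add: \<theta>)
  finally have "(\<Sum>\<tau>\<in>ordered_simplices X k. (\<chi> \<tau>)\<^sup>2) = 0" by simp
  then have "\<chi> \<tau> = 0" if "\<tau> \<in> ordered_simplices X k" for \<tau>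
    using that finS[of k] by (simp add: sum_nonneg_eq_0_iff)
  then have "\<chi> \<tau> = 0" for \<tau> using \<chi>0 by blast
  then show thesis
    using that[OF \<psi>] by (simp add: \<chi>_def \<theta>_def)
qed

lemma self_quotient_trivial:
  assumes "group G"
  shows "trivial_group (G Mod carrier G)"
proof -
  interpret group G by (rule assms)
  have sub: "subgroup (carrier G) G" by (rule subgroup_self)
  have "carrier G #>\<^bsub>G\<^esub> x = carrier G" if "x \<in> carrier G" for x
    using coset_join2[OF that sub that] .
  then have "carrier (G Mod carrier G) = {carrier G}"
    unfolding carrier_FactGroup using one_closed by auto
  moreover have "carrier G \<lhd> G"
    using sub by (intro normal_invI) auto
  then have "group (G Mod carrier G)"
    by (rule normal.factorgroup_is_group)
  ultimately show ?thesis by (simp add: trivial_group_def)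
qed

lemma reduced_cocycles_linear_combination:
  assumes "\<phi> \<in> reduced_cocycles X k" "\<psi> \<in> reduced_cocycles X k"
  shows "(\<lambda>xs. a * \<phi> xs + b * \<psi> xs) \<in> reduced_cocycles X k"
  using assms by (simp add: reduced_cocycles_def cochains_linear_combination coboundary_linear_combination)

lemma group_reduced_cocycles: "group (reduced_cocycle_group X k)"
proof -
  have zero: "(\<lambda>xs. 0) \<in> reduced_cocycles X k"
    by (simp add: reduced_cocycles_def cochains_def coboundary_def)
  show ?thesis
  proof (rule groupI)
    fix \<phi> \<psi> assume "\<phi> \<in> carrier (reduced_cocycle_group X k)" "\<psi> \<in> carrier (reduced_cocycle_group X k)"
    then show "\<phi> \<otimes>\<^bsub>reduced_cocycle_group X k\<^esub> \<psi> \<in> carrier (reduced_cocycle_group X k)"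
      using reduced_cocycles_linear_combination[of \<phi> X k \<psi> 1 1] by (simp add: reduced_cocycle_group_def)
  next
    fix \<phi> assume \<phi>: "\<phi> \<in> carrier (reduced_cocycle_group X k)"
    show "\<exists>\<psi>\<in>carrier (reduced_cocycle_group X k).
        \<psi> \<otimes>\<^bsub>reduced_cocycle_group X k\<^esub> \<phi> = \<one>\<^bsub>reduced_cocycle_group X k\<^esub>"
      using \<phi> reduced_cocycles_linear_combination[of \<phi> X k \<phi> "- 1" 0]
      by (intro bexI[of _ "\<lambda>xs. - \<phi> xs"]) (simp_all add: reduced_cocycle_group_def)
  qed (simp_all add: reduced_cocycle_group_def zero add.assoc)
qed

theorem corollary1p7:
  fixes X :: "'a set set" and k n :: nat
  assumes "k \<ge> 1"
    and "finite_complex X"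
    and "complex_connected X"
    and "card (complex_vertices X) = n"
    and "complex_skeleton k X = complex_skeleton k (clique_complex (one_skeleton_graph X))"
    and "spectral_gap (one_skeleton_graph X)
           > real k * real n / (real k + 1) + (real k + 1) * real (D_max X k)"
  shows "trivial_group (reduced_cohomology X k)"
proof -
  define G where "G = one_skeleton_graph X"
  let ?V = "complex_vertices X"
  have V: "fst G = ?V" by (simp add: G_def)
  note X = assms(2)
  note fin = finite_complex_vertices[OF X]
  have finS: "finite (ordered_simplices X m)" for m
    using finite_ordered_simplices[OF fin] simplex_subset_vertices[OF X] by blast
  have cob: "coboundary X k \<psi> \<in> reduced_cocycles X k" if "\<psi> \<in> cochains X k" for \<psi>
    using that coboundary_in_cochains[OF that] coboundary_coboundary[OF X] by (simp add: reduced_cocycles_def)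
  have "\<phi> \<in> reduced_coboundaries X k" if \<phi>: "\<phi> \<in> reduced_cocycles X k" for \<phi>
  proof -
    have \<phi>C: "\<phi> \<in> cochains X (k + 1)" using \<phi> by (simp add: reduced_cocycles_def)
    obtain \<psi> where \<psi>: "\<psi> \<in> cochains X k"
      and coclosed: "\<And>\<tau>. (\<Sum>u\<in>?V. \<phi> (u # \<tau>) - coboundary X k \<psi> (u # \<tau>)) = 0"
      using exists_coclosed_representative[OF X \<phi>C] by blast
    define \<theta> where "\<theta> = (\<lambda>\<sigma>. \<phi> \<sigma> - coboundary X k \<psi> \<sigma>)"
    have "(\<lambda>\<sigma>. 1 * \<phi> \<sigma> + (- 1) * coboundary X k \<psi> \<sigma>) \<in> reduced_cocycles X k"
      by (rule reduced_cocycles_linear_combination[OF \<phi> cob[OF \<psi>]])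
    then have \<theta>: "\<theta> \<in> reduced_cocycles X k" by (simp add: \<theta>_def)
    then have supp: "\<theta> xs = 0" if "xs \<notin> ordered_simplices X (Suc k)" for xs
      using that by (simp add: reduced_cocycles_def cochains_iff)
    define N where "N = (\<Sum>\<sigma>\<in>ordered_simplices X (Suc k). (\<theta> \<sigma>)\<^sup>2)"
    define Q where "Q = (\<Sum>\<tau>\<in>ordered_simplices X k. \<Sum>x\<in>?V. \<Sum>y\<in>?V. laplacian G x y * \<theta> (x # \<tau>) * \<theta> (y # \<tau>))"
    \<comment> \<open>each \<open>u \<mapsto> \<theta> (u # \<tau>)\<close> has mean zero, so the spectral gap bounds its Laplacian form from below\<close>
    have "N = (\<Sum>\<tau>\<in>ordered_simplices X k. \<Sum>x\<in>?V. (\<theta> (x # \<tau>))\<^sup>2)"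
      unfolding N_def by (rule sum_supported_Suc[OF X]) (simp add: supp)
    then have "spectral_gap G * N
        = (\<Sum>\<tau>\<in>ordered_simplices X k. spectral_gap G * (\<Sum>x\<in>?V. (\<theta> (x # \<tau>))\<^sup>2))"
      by (simp add: sum_distrib_left)
    also have "\<dots> \<le> Q"
      unfolding Q_def
    proof (rule sum_mono)
      fix \<tau>
      have "(\<Sum>x\<in>fst G. \<theta> (x # \<tau>)) = 0" using coclosed unfolding V \<theta>_def .
      then show "spectral_gap G * (\<Sum>x\<in>?V. (\<theta> (x # \<tau>))\<^sup>2)
          \<le> (\<Sum>x\<in>?V. \<Sum>y\<in>?V. laplacian G x y * \<theta> (x # \<tau>) * \<theta> (y # \<tau>))"
        using spectral_gap_le_rayleigh[of G "\<lambda>x. \<theta> (x # \<tau>)"] fin assms(3)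
        unfolding V complex_connected_def G_def[symmetric] by blast
    qed
    finally have "(real k + 1) * (spectral_gap G * N) \<le> (real k + 1) * Q"
      by (simp add: mult_left_mono)
    also have "\<dots> \<le> (real k * real n + (real k + 2) * real (D_max X k)) * N"
      using cocycle_laplacian_bound[OF X assms(5) \<theta>] unfolding Q_def N_def G_def assms(4) .
    finally have upper: "((real k + 1) * spectral_gap G) * N
        \<le> (real k * real n + (real k + 2) * real (D_max X k)) * N"
      by (simp add: mult.assoc)
    have "real k + 2 \<le> (real k + 1)\<^sup>2"
      using assms(1) by (simp add: power2_eq_square algebra_simps add_increasing2)
    then have "real k * real n + (real k + 2) * real (D_max X k)
        \<le> real k * real n + (real k + 1)\<^sup>2 * real (D_max X k)"
      by (intro add_left_mono mult_right_mono) auto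
    also have "\<dots> = (real k + 1) * (real k * real n / (real k + 1) + (real k + 1) * real (D_max X k))"
      by (simp add: power2_eq_square field_simps)
    also have "\<dots> < (real k + 1) * spectral_gap G"
      using assms(6) unfolding G_def by (intro mult_strict_left_mono) auto
    finally have "\<not> N > 0"
      using upper by (auto dest: mult_right_le_imp_le)
    moreover have "N \<ge> 0" unfolding N_def by (rule sum_nonneg) simp
    ultimately have "N = 0" by simp
    then have "\<theta> \<sigma> = 0" if "\<sigma> \<in> ordered_simplices X (Suc k)" for \<sigma>
      using that finS unfolding N_def by (simp add: sum_nonneg_eq_0_iff)
    then have "\<theta> \<sigma> = 0" for \<sigma> using supp by blast
    then have "\<phi> = coboundary X k \<psi>" by (auto simp: \<theta>_def fun_eq_iff)
    then show ?thesis using \<psi> by (auto simp: reduced_coboundaries_def)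
  qed
  moreover have "reduced_coboundaries X k \<subseteq> reduced_cocycles X k"
    unfolding reduced_coboundaries_def using cob by blast
  ultimately have "reduced_coboundaries X k = carrier (reduced_cocycle_group X k)"
    by (auto simp: reduced_cocycle_group_def)
  then show ?thesis
    unfolding reduced_cohomology_def using self_quotient_trivial[OF group_reduced_cocycles] by simp
qed

end
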